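(* Let $K$ be a field and let $P$ be the set of infinite root series over $K$ (with pointwise addition). The formula $$(ab)(q)=\sum_{0\leq r\leq q}a(r)\,b(q-r)\qquad(q\in[0,1])$$ gives a well-defined ring structure on $P$. With this structure, $P$ is self-injective and totally incoherent. The reduced quotient is $P/\sqrt{0}=K$.
   Context: For a map $a\colon[0,1]\to K$ (where $[0,1]$ is the real unit interval) put $\operatorname{supp}(a)=\{q\in[0,1]\mid a(q)\neq 0\}$. We say $a$ is an infinite root series if every nonempty subset of $\operatorname{supp}(a)$ has a smallest element (so $\operatorname{supp}(a)$ is well-ordered). $P$ is regarded as an ungraded object (equivalently, graded and concentrated in degree zero). A commutative ring $R$ is self-injective if $R$ is injective as an $R$-module. $R$ is totally incoherent if the only finitely presented ideals are $0$ and $R$. $\sqrt{0}$ is the ideal of nilpotent elements. *)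

theory Defs
  imports Complex_Main "HOL-Algebra.Algebra"
begin

section \<open>Infinite root series\<close>

definition supp :: "('k, 'c) ring_scheme \<Rightarrow> (real \<Rightarrow> 'k) \<Rightarrow> real set"
  where "supp K a = {q \<in> {0..1}. a q \<noteq> \<zero>\<^bsub>K\<^esub>}"

text \<open>
  Maps \<open>[0,1] \<rightarrow> K\<close> are represented as extensional functions on the reals.
\<close>

definition root_series :: "('k, 'c) ring_scheme \<Rightarrow> (real \<Rightarrow> 'k) set"
  where "root_series K =
    {a \<in> {0..1} \<rightarrow>\<^sub>E carrier K.
      \<forall>S. S \<subseteq> supp K a \<and> S \<noteq> {} \<longrightarrow> (\<exists>m\<in>S. \<forall>s\<in>S. m \<le> s)}"

definition conv_supp :: "('k, 'c) ring_scheme \<Rightarrow> (real \<Rightarrow> 'k) \<Rightarrow> (real \<Rightarrow> 'k) \<Rightarrow> real \<Rightarrow> real set"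
  where "conv_supp K a b q = {r \<in> {0..q}. a r \<otimes>\<^bsub>K\<^esub> b (q - r) \<noteq> \<zero>\<^bsub>K\<^esub>}"

text \<open>
  The sum over \<open>0 \<le> r \<le> q\<close> is the sum over the nonzero terms. \<^const>\<open>finsum\<close> is a dummy on
  infinite index sets, so the formula is meaningful exactly when \<^const>\<open>conv_supp\<close> is finite.
\<close>

definition conv :: "('k, 'c) ring_scheme \<Rightarrow> (real \<Rightarrow> 'k) \<Rightarrow> (real \<Rightarrow> 'k) \<Rightarrow> real \<Rightarrow> 'k"
  where "conv K a b =
    (\<lambda>q\<in>{0..1}. \<Oplus>\<^bsub>K\<^esub>r\<in>conv_supp K a b q. a r \<otimes>\<^bsub>K\<^esub> b (q - r))"

definition const_series :: "('k, 'c) ring_scheme \<Rightarrow> 'k \<Rightarrow> real \<Rightarrow> 'k"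
  where "const_series K c = (\<lambda>q\<in>{0..1}. if q = 0 then c else \<zero>\<^bsub>K\<^esub>)"

definition root_series_ring :: "('k, 'c) ring_scheme \<Rightarrow> (real \<Rightarrow> 'k) ring"
  where "root_series_ring K =
    \<lparr> carrier = root_series K,
      monoid.mult = conv K,
      monoid.one = const_series K \<one>\<^bsub>K\<^esub>,
      ring.zero = (\<lambda>q\<in>{0..1}. \<zero>\<^bsub>K\<^esub>),
      ring.add = (\<lambda>a b. \<lambda>q\<in>{0..1}. a q \<oplus>\<^bsub>K\<^esub> b q) \<rparr>"


section \<open>Modules over a commutative ring\<close>

definition lin_hom ::
    "('r, 'c) ring_scheme \<Rightarrow> ('r, 'm, 'd) module_scheme \<Rightarrow> ('r, 'n, 'e) module_scheme \<Rightarrow> ('m \<Rightarrow> 'n) set"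
  where "lin_hom R M N =
    {f \<in> carrier M \<rightarrow> carrier N.
      (\<forall>x\<in>carrier M. \<forall>y\<in>carrier M. f (x \<oplus>\<^bsub>M\<^esub> y) = f x \<oplus>\<^bsub>N\<^esub> f y) \<and>
      (\<forall>r\<in>carrier R. \<forall>x\<in>carrier M. f (r \<odot>\<^bsub>M\<^esub> x) = r \<odot>\<^bsub>N\<^esub> f x)}"

text \<open>
  A module record extends a ring record. Its \<open>mult\<close> and \<open>one\<close> fields play no role in the notion
  of a module and are filled in below only because the record requires them.
\<close>

definition ideal_module :: "('r, 'c) ring_scheme \<Rightarrow> 'r set \<Rightarrow> ('r, 'r) module"
  where "ideal_module R I =
    \<lparr> carrier = I, monoid.mult = monoid.mult R, monoid.one = \<one>\<^bsub>R\<^esub>,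
      ring.zero = \<zero>\<^bsub>R\<^esub>, ring.add = ring.add R, smult = monoid.mult R \<rparr>"

definition free_module :: "('r, 'c) ring_scheme \<Rightarrow> nat \<Rightarrow> ('r, nat \<Rightarrow> 'r) module"
  where "free_module R n =
    \<lparr> carrier = {..<n} \<rightarrow>\<^sub>E carrier R,
      monoid.mult = (\<lambda>x y. \<lambda>i\<in>{..<n}. x i \<otimes>\<^bsub>R\<^esub> y i),
      monoid.one = (\<lambda>i\<in>{..<n}. \<one>\<^bsub>R\<^esub>),
      ring.zero = (\<lambda>i\<in>{..<n}. \<zero>\<^bsub>R\<^esub>),
      ring.add = (\<lambda>x y. \<lambda>i\<in>{..<n}. x i \<oplus>\<^bsub>R\<^esub> y i),
      smult = (\<lambda>r x. \<lambda>i\<in>{..<n}. r \<otimes>\<^bsub>R\<^esub> x i) \<rparr>"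

text \<open>
  The test modules \<open>M\<close> and \<open>N\<close> range over all modules with elements in the types \<open>'m\<close> and \<open>'n\<close>.
  HOL cannot quantify over types inside a formula, so these two types are parameters; a theorem in
  which they are left as type variables asserts the extension property for all modules.
\<close>

definition injective_module ::
    "'m itself \<Rightarrow> 'n itself \<Rightarrow> ('r, 'c) ring_scheme \<Rightarrow> ('r, 'e, 'd) module_scheme \<Rightarrow> bool"
  where "injective_module _ _ R E \<longleftrightarrow>
    Module.module R E \<and>
    (\<forall>(M :: ('r, 'm) module) (N :: ('r, 'n) module) i f.
      Module.module R M \<and> Module.module R N \<and>
      i \<in> lin_hom R M N \<and> inj_on i (carrier M) \<and> f \<in> lin_hom R M E \<longrightarrow>
      (\<exists>g \<in> lin_hom R N E. \<forall>x\<in>carrier M. g (i x) = f x))"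

definition self_injective :: "'m itself \<Rightarrow> 'n itself \<Rightarrow> ('r, 'c) ring_scheme \<Rightarrow> bool"
  where "self_injective TM TN R \<longleftrightarrow> injective_module TM TN R (ideal_module R (carrier R))"

text \<open>Existence of an exact sequence \<open>R\<^sup>m \<rightarrow> R\<^sup>n \<rightarrow> M \<rightarrow> 0\<close>.\<close>

definition finitely_presented :: "('r, 'c) ring_scheme \<Rightarrow> ('r, 'm, 'd) module_scheme \<Rightarrow> bool"
  where "finitely_presented R M \<longleftrightarrow>
    Module.module R M \<and>
    (\<exists>m n. \<exists>f \<in> lin_hom R (free_module R m) (free_module R n). \<exists>g \<in> lin_hom R (free_module R n) M.
      g ` carrier (free_module R n) = carrier M \<and>
      f ` carrier (free_module R m) = {x \<in> carrier (free_module R n). g x = \<zero>\<^bsub>M\<^esub>})"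

definition totally_incoherent :: "('r, 'c) ring_scheme \<Rightarrow> bool"
  where "totally_incoherent R \<longleftrightarrow>
    {I. ideal I R \<and> finitely_presented R (ideal_module R I)} = {{\<zero>\<^bsub>R\<^esub>}, carrier R}"

definition nilradical :: "('r, 'c) ring_scheme \<Rightarrow> 'r set"
  where "nilradical R = {a \<in> carrier R. \<exists>n::nat. a [^]\<^bsub>R\<^esub> n = \<zero>\<^bsub>R\<^esub>}"

end

theory Submission
  imports Defs
begin

text \<open>
  Write \<open>t\<^sup>u\<close> for the series with the single coefficient 1 at exponent \<open>u\<close>. Everything rests on two
  facts. First, well-ordered sets of reals are well behaved under addition: \<open>A + B\<close> is again
  well-ordered and each of its elements has finitely many representations
  (\<open>well_ordered_sum\<close>, \<open>finite_antidiagonal\<close>). So the product is given by finite sums and is again a root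
  series, and associativity is an exchange of two finite sums. Second, a series whose constant term
  vanishes is nilpotent, since the exponents of its \<open>n\<close>-th power are at least \<open>n\<close> times its least
  exponent and finally exceed 1. So a series with nonzero constant term is a unit, by the geometric
  series, and every nonzero series is a unit times \<open>t\<^sup>u\<close>, where \<open>u\<close> is its least exponent
  (\<open>associated_to_monomial\<close>). Divisibility thus compares least exponents.

  The reduced quotient is immediate: the nilradical is the kernel of the constant term.

  Self-injectivity. By Baer's criterion (\<open>baer_criterion\<close>) it is enough to show that a linear map
  \<open>f\<close> from an ideal \<open>I\<close> to the ring is multiplication by some series \<open>z\<close>. The coefficient at 1 tells what
  \<open>z\<close> must be: if \<open>f(x) = x z\<close>, then \<open>z(s)\<close> is the coefficient at 1 of \<open>t\<^sup>1\<^sup>-\<^sup>s z = f(t\<^sup>1\<^sup>-\<^sup>s)\<close>. Taking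
  this as the definition of \<open>z(s)\<close> when \<open>t\<^sup>1\<^sup>-\<^sup>s\<close> lies in \<open>I\<close>, and 0 otherwise, works
  (\<open>ideal_hom_is_multiplication\<close>). Well-ordering of the support
  is automatic, because below any of its elements \<open>s\<close> the series \<open>z\<close> is a shifted piece of the
  single root series \<open>f(t\<^sup>1\<^sup>-\<^sup>s)\<close>.

  Total incoherence. A finitely generated nonzero ideal is generated by the generator \<open>x\<close> of least
  exponent \<open>u\<close>. If \<open>u = 0\<close> it is the whole ring. If \<open>u > 0\<close> and the ideal is finitely presented, then the
  annihilator of \<open>x\<close> is finitely generated. But this annihilator consists of the series whose
  exponents all exceed \<open>1 - u\<close>, and finitely many of those have exponents bounded away from \<open>1 - u\<close>,
  while \<open>t\<^sup>s\<close> belongs to it for \<open>s\<close> arbitrarily close to \<open>1 - u\<close>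
  (\<open>finitely_presented_ideal_trivial\<close>).
\<close>

section \<open>Well-ordered sets\<close>

definition well_ordered :: "'a::linorder set \<Rightarrow> bool"
  where "well_ordered A \<longleftrightarrow> (\<forall>S. S \<subseteq> A \<and> S \<noteq> {} \<longrightarrow> (\<exists>m\<in>S. \<forall>s\<in>S. m \<le> s))"

lemma well_orderedD:
  assumes "well_ordered A" "S \<subseteq> A" "x \<in> S"
  shows "\<exists>m\<in>S. \<forall>s\<in>S. m \<le> s"
  using assms unfolding well_ordered_def by blast

lemma well_ordered_subset: "well_ordered A \<Longrightarrow> B \<subseteq> A \<Longrightarrow> well_ordered B"
  unfolding well_ordered_def by blast

lemma well_ordered_singleton [simp]: "well_ordered {x}"
  unfolding well_ordered_def by (auto simp: subset_singleton_iff)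

lemma well_ordered_Un:
  assumes "well_ordered A" "well_ordered B"
  shows "well_ordered (A \<union> B)"
  unfolding well_ordered_def
proof (intro allI impI, elim conjE)
  fix S assume S: "S \<subseteq> A \<union> B" "S \<noteq> {}"
  show "\<exists>m\<in>S. \<forall>s\<in>S. m \<le> s"
  proof (cases "S \<inter> A = {} \<or> S \<inter> B = {}")
    case True
    then have "S \<subseteq> A \<or> S \<subseteq> B" using S by blast
    moreover obtain x where "x \<in> S" using S by blast
    ultimately show ?thesis
      using well_orderedD[OF assms(1), of S x] well_orderedD[OF assms(2), of S x] by blast
  next
    case False
    then obtain x y where "x \<in> S \<inter> A" "y \<in> S \<inter> B" by blast
    then obtain a b where a: "a \<in> S \<inter> A" "\<forall>s\<in>S \<inter> A. a \<le> s"
      and b: "b \<in> S \<inter> B" "\<forall>s\<in>S \<inter> B. b \<le> s"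
      using well_orderedD[OF assms(1), of "S \<inter> A" x] well_orderedD[OF assms(2), of "S \<inter> B" y] by blast
    have "\<forall>s\<in>S. min a b \<le> s" using a b S by (auto simp: min_le_iff_disj)
    moreover have "min a b \<in> S" using a b by (auto simp: min_def)
    ultimately show ?thesis by blast
  qed
qed

text \<open>
  If \<open>A\<close> were infinite, its maximum would have infinitely many elements below it. Take the least
  element with this property; the largest element strictly below it has the property too, a
  contradiction.
\<close>

lemma finite_if_well_ordered_both_ways:
  fixes A :: "'a::linorder set"
  assumes lo: "well_ordered A"
    and hi: "\<And>S. S \<subseteq> A \<Longrightarrow> S \<noteq> {} \<Longrightarrow> \<exists>m\<in>S. \<forall>s\<in>S. s \<le> m"
  shows "finite A"
proof -
  have fin: "finite {y\<in>A. y \<le> x}" if "x \<in> A" for x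
  proof (rule ccontr)
    assume "infinite {y\<in>A. y \<le> x}"
    then have "\<exists>m\<in>{x\<in>A. infinite {y\<in>A. y \<le> x}}. \<forall>s\<in>{x\<in>A. infinite {y\<in>A. y \<le> x}}. m \<le> s"
      using that by (intro well_orderedD[OF lo, of _ x]) auto
    then obtain m where m: "m \<in> A" "infinite {y\<in>A. y \<le> m}"
      and least: "\<And>s. s \<in> A \<Longrightarrow> infinite {y\<in>A. y \<le> s} \<Longrightarrow> m \<le> s"
      by auto
    have eq: "{y\<in>A. y \<le> m} = insert m {y\<in>A. y < m}" using m by auto
    then have inf: "infinite {y\<in>A. y < m}" using m by simp
    then have "{y\<in>A. y < m} \<noteq> {}" by (metis finite.emptyI)
    then obtain p where p: "p \<in> A" "p < m" "\<forall>s\<in>{y\<in>A. y < m}. s \<le> p"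
      using hi[of "{y\<in>A. y < m}"] by blast
    then have "{y\<in>A. y < m} \<subseteq> {y\<in>A. y \<le> p}" by blast
    then have "infinite {y\<in>A. y \<le> p}" using inf by (rule infinite_super)
    then have "m \<le> p" by (rule least[OF \<open>p \<in> A\<close>])
    then show False using p by simp
  qed
  show ?thesis
  proof (cases "A = {}")
    case False
    then obtain m where "m \<in> A" "\<forall>s\<in>A. s \<le> m" using hi[of A] by blast
    then have "A = {y\<in>A. y \<le> m}" by blast
    then show ?thesis using fin[OF \<open>m \<in> A\<close>] by simp
  qed simp
qed

text \<open>
  The map \<open>x \<mapsto> q - x\<close> reverses the order, so well-ordering of \<open>B\<close> provides maxima on the
  \<open>A\<close>-side.
\<close>

lemma finite_antidiagonal:
  fixes A B :: "real set"
  assumes "well_ordered A" "well_ordered B"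
  shows "finite {x\<in>A. q - x \<in> B}"
proof (rule finite_if_well_ordered_both_ways)
  show "well_ordered {x\<in>A. q - x \<in> B}"
    by (rule well_ordered_subset[OF assms(1)]) blast
  fix S assume S: "S \<subseteq> {x\<in>A. q - x \<in> B}" "S \<noteq> {}"
  then obtain x where "x \<in> S" by blast
  then have "\<exists>m\<in>(\<lambda>x. q - x) ` S. \<forall>s\<in>(\<lambda>x. q - x) ` S. m \<le> s"
    using S by (intro well_orderedD[OF assms(2), of _ "q - x"]) auto
  then obtain m where "m \<in> S" "\<And>s. s \<in> S \<Longrightarrow> q - m \<le> q - s" by auto
  then show "\<exists>m\<in>S. \<forall>s\<in>S. s \<le> m" by (intro bexI[of _ m]) auto
qed

text \<open>
  The pairs in \<open>A \<times> B\<close> that are minimal for the componentwise order among those with sum in \<open>S\<close> form an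
  antichain: as the first component grows, the second one decreases. Hence the first components are
  well-ordered in both directions, so there are finitely many minimal pairs. Every pair with sum in
  \<open>S\<close> lies above a minimal one, so the smallest of these finitely many sums is the minimum of \<open>S\<close>.
\<close>

lemma well_ordered_sum:
  fixes A B :: "real set"
  assumes A: "well_ordered A" and B: "well_ordered B"
  shows "well_ordered {z. \<exists>x\<in>A. \<exists>y\<in>B. z = x + y}"
  unfolding well_ordered_def
proof (intro allI impI, elim conjE)
  fix S assume S: "S \<subseteq> {z. \<exists>x\<in>A. \<exists>y\<in>B. z = x + y}" "S \<noteq> {}"
  define D where "D = {(x, y). x \<in> A \<and> y \<in> B \<and> x + y \<in> S}"
  \<comment> \<open>the minimal pairs\<close>
  define M where "M = {(x, y). (x, y) \<in> D \<and>
    (\<forall>x' y'. (x', y') \<in> D \<and> x' \<le> x \<and> y' \<le> y \<longrightarrow> x' = x \<and> y' = y)}"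
  have dominated: "\<exists>x' y'. (x', y') \<in> M \<and> x' \<le> x \<and> y' \<le> y" if "(x, y) \<in> D" for x y
  proof -
    define U where "U = {x'. \<exists>y'. (x', y') \<in> D \<and> y' \<le> y}"
    have "\<exists>u\<in>U. \<forall>s\<in>U. u \<le> s"
      using that by (intro well_orderedD[OF A, of _ x]) (auto simp: U_def D_def)
    then obtain u y1 where u: "y1 \<le> y" "(u, y1) \<in> D"
      and u_least: "\<And>x' y'. y' \<le> y \<Longrightarrow> (x', y') \<in> D \<Longrightarrow> u \<le> x'"
      unfolding U_def by blast
    define Y where "Y = {y'. (u, y') \<in> D}"
    have "\<exists>v\<in>Y. \<forall>s\<in>Y. v \<le> s"
      using u by (intro well_orderedD[OF B, of _ y1]) (auto simp: Y_def D_def)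
    then obtain v where v: "(u, v) \<in> D" and v_least: "\<And>y'. (u, y') \<in> D \<Longrightarrow> v \<le> y'"
      unfolding Y_def by blast
    have "v \<le> y" using v_least[OF u(2)] u(1) by simp
    have "(u, v) \<in> M"
      unfolding M_def
    proof (clarsimp simp: v)
      fix x' y' assume *: "(x', y') \<in> D" "x' \<le> u" "y' \<le> v"
      then have "u \<le> x'" using u_least[of y' x'] \<open>v \<le> y\<close> by simp
      then have "x' = u" using * by simp
      then show "x' = u \<and> y' = v" using v_least[of y'] * by simp
    qed
    moreover have "u \<le> x" using u_least[of y x] that by simp
    ultimately show ?thesis using \<open>v \<le> y\<close> by blast
  qed
  have inj: "y = y'" if "(x, y) \<in> M" "(x, y') \<in> M" for x y y'
  proof -
    from that have "(x, y) \<in> D" "(x, y') \<in> D" unfolding M_def by auto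
    with that have "y \<le> y' \<Longrightarrow> y = y'" "y' \<le> y \<Longrightarrow> y = y'" unfolding M_def by (blast, blast)
    then show "y = y'" by linarith
  qed
  have "finite (fst ` M)"
  proof (rule finite_if_well_ordered_both_ways)
    show "well_ordered (fst ` M)"
      by (rule well_ordered_subset[OF A]) (auto simp: M_def D_def)
    fix T assume T: "T \<subseteq> fst ` M" "T \<noteq> {}"
    then obtain x0 y0 where "(x0, y0) \<in> M" "x0 \<in> T" by fastforce
    define Y where "Y = {y. \<exists>x\<in>T. (x, y) \<in> M}"
    have "\<exists>y\<in>Y. \<forall>s\<in>Y. y \<le> s"
      using \<open>(x0, y0) \<in> M\<close> \<open>x0 \<in> T\<close>
      by (intro well_orderedD[OF B, of _ y0]) (auto simp: Y_def M_def D_def)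
    then obtain y x where xy: "x \<in> T" "(x, y) \<in> M"
      and least: "\<And>x' y'. x' \<in> T \<Longrightarrow> (x', y') \<in> M \<Longrightarrow> y \<le> y'"
      unfolding Y_def by blast
    have "x' \<le> x" if x': "x' \<in> T" for x'
    proof (rule ccontr)
      assume "\<not> x' \<le> x"
      obtain y' where y': "(x', y') \<in> M" using T x' by fastforce
      with least x' have "y \<le> y'" by blast
      then show False using y' xy \<open>\<not> x' \<le> x\<close> unfolding M_def by fastforce
    qed
    then show "\<exists>m\<in>T. \<forall>s\<in>T. s \<le> m" using xy by blast
  qed
  moreover have "inj_on fst M" using inj by (auto simp: inj_on_def)
  ultimately have "finite M" by (rule finite_imageD)
  then have fin: "finite ((\<lambda>(x, y). x + y) ` M)" by simp
  obtain x y where "(x, y) \<in> D" using S unfolding D_def by blast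
  then have ne: "(\<lambda>(x, y). x + y) ` M \<noteq> {}" using dominated by fastforce
  let ?m = "Min ((\<lambda>(x, y). x + y) ` M)"
  have "?m \<in> (\<lambda>(x, y). x + y) ` M" using Min_in[OF fin ne] .
  moreover have "(\<lambda>(x, y). x + y) ` M \<subseteq> S" unfolding M_def D_def by auto
  ultimately have "?m \<in> S" by (rule rev_subsetD)
  moreover have "?m \<le> s" if s: "s \<in> S" for s
  proof -
    obtain x y where xy: "s = x + y" "x \<in> A" "y \<in> B" using S(1) s by blast
    then have "(x, y) \<in> D" using s unfolding D_def by blast
    then obtain x' y' where "(x', y') \<in> M" "x' \<le> x" "y' \<le> y" using dominated by blast
    moreover from this have "?m \<le> x' + y'" by (intro Min_le[OF fin]) force
    ultimately show ?thesis using xy by simp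
  qed
  ultimately show "\<exists>m\<in>S. \<forall>s\<in>S. m \<le> s" by blast
qed

section \<open>Extending linear maps into a module\<close>

lemma lin_homD:
  assumes "f \<in> lin_hom R M N"
  shows "x \<in> carrier M \<Longrightarrow> f x \<in> carrier N"
    and "x \<in> carrier M \<Longrightarrow> y \<in> carrier M \<Longrightarrow> f (x \<oplus>\<^bsub>M\<^esub> y) = f x \<oplus>\<^bsub>N\<^esub> f y"
    and "r \<in> carrier R \<Longrightarrow> x \<in> carrier M \<Longrightarrow> f (r \<odot>\<^bsub>M\<^esub> x) = r \<odot>\<^bsub>N\<^esub> f x"
  using assms unfolding lin_hom_def by auto

lemma lin_hom_zero:
  assumes "Module.module R M" "Module.module R N" "f \<in> lin_hom R M N"
  shows "f \<zero>\<^bsub>M\<^esub> = \<zero>\<^bsub>N\<^esub>"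
proof -
  interpret M: Module.module R M by fact
  interpret N: Module.module R N by fact
  have "f (\<zero>\<^bsub>R\<^esub> \<odot>\<^bsub>M\<^esub> \<zero>\<^bsub>M\<^esub>) = \<zero>\<^bsub>R\<^esub> \<odot>\<^bsub>N\<^esub> f \<zero>\<^bsub>M\<^esub>"
    by (rule lin_homD(3)[OF assms(3)]) auto
  then show ?thesis using lin_homD(1)[OF assms(3)] by simp
qed

lemma ideal_module_is_module:
  assumes "cring R" "ideal I R"
  shows "Module.module R (ideal_module R I)"
proof -
  interpret cring R by fact
  interpret ideal I R by fact
  note c = a_subset[THEN subsetD]
  show ?thesis
  proof (rule moduleI)
    show "abelian_group (ideal_module R I)"
    proof (rule abelian_groupI)
      fix x assume "x \<in> carrier (ideal_module R I)"
      then show "\<exists>y\<in>carrier (ideal_module R I). y \<oplus>\<^bsub>ideal_module R I\<^esub> x = \<zero>\<^bsub>ideal_module R I\<^esub>"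
        using c by (auto simp: ideal_module_def intro!: bexI[of _ "\<ominus>\<^bsub>R\<^esub> x"] l_neg)
    qed (use c in \<open>auto simp: ideal_module_def a_ac\<close>)
  qed (use c in \<open>auto simp: ideal_module_def is_cring m_assoc l_distr r_distr intro: I_l_closed\<close>)
qed

text \<open>
  A linear map from a submodule of \<open>N\<close> to \<open>E\<close>, encoded as its graph. This makes extension the
  inclusion of sets, as Zorn's lemma wants it. For a submodule of the product, being single-valued
  need only be required at 0.
\<close>

definition partial_lin_map ::
    "('r, 'c) ring_scheme \<Rightarrow> ('r, 'n, 'd) module_scheme \<Rightarrow> ('r, 'e, 'f) module_scheme \<Rightarrow> ('n \<times> 'e) set \<Rightarrow> bool"
  where "partial_lin_map R N E G \<longleftrightarrow>
    G \<subseteq> carrier N \<times> carrier E \<and>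
    (\<zero>\<^bsub>N\<^esub>, \<zero>\<^bsub>E\<^esub>) \<in> G \<and>
    (\<forall>x e y d. (x, e) \<in> G \<and> (y, d) \<in> G \<longrightarrow> (x \<oplus>\<^bsub>N\<^esub> y, e \<oplus>\<^bsub>E\<^esub> d) \<in> G) \<and>
    (\<forall>r\<in>carrier R. \<forall>x e. (x, e) \<in> G \<longrightarrow> (r \<odot>\<^bsub>N\<^esub> x, r \<odot>\<^bsub>E\<^esub> e) \<in> G) \<and>
    (\<forall>e. (\<zero>\<^bsub>N\<^esub>, e) \<in> G \<longrightarrow> e = \<zero>\<^bsub>E\<^esub>)"

lemma partial_lin_map_unique:
  assumes N: "Module.module R N" and E: "Module.module R E" and G: "partial_lin_map R N E G"
    and xe: "(x, e) \<in> G" "(x, d) \<in> G"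
  shows "e = d"
proof -
  interpret N: Module.module R N by fact
  interpret E: Module.module R E by fact
  have c: "x \<in> carrier N" "e \<in> carrier E" "d \<in> carrier E"
    using G xe unfolding partial_lin_map_def by auto
  have minus: "(\<ominus>\<^bsub>R\<^esub> \<one>\<^bsub>R\<^esub>) \<odot>\<^bsub>N\<^esub> x = \<ominus>\<^bsub>N\<^esub> x" "(\<ominus>\<^bsub>R\<^esub> \<one>\<^bsub>R\<^esub>) \<odot>\<^bsub>E\<^esub> d = \<ominus>\<^bsub>E\<^esub> d"
    using c by (simp_all add: N.smult_l_minus E.smult_l_minus)
  have "((\<ominus>\<^bsub>R\<^esub> \<one>\<^bsub>R\<^esub>) \<odot>\<^bsub>N\<^esub> x, (\<ominus>\<^bsub>R\<^esub> \<one>\<^bsub>R\<^esub>) \<odot>\<^bsub>E\<^esub> d) \<in> G"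
    using G xe unfolding partial_lin_map_def by auto
  then have "(x \<oplus>\<^bsub>N\<^esub> \<ominus>\<^bsub>N\<^esub> x, e \<oplus>\<^bsub>E\<^esub> \<ominus>\<^bsub>E\<^esub> d) \<in> G"
    using G xe unfolding partial_lin_map_def minus by blast
  then have "e \<oplus>\<^bsub>E\<^esub> \<ominus>\<^bsub>E\<^esub> d = \<zero>\<^bsub>E\<^esub>"
    using G c unfolding partial_lin_map_def by (simp add: N.M.r_neg)
  then show ?thesis using c
    by (metis E.M.add.inv_closed E.M.add.inv_equality E.M.minus_minus)
qed

lemma cring_idealI:
  assumes "cring R" and sub: "I \<subseteq> carrier R" and z: "\<zero>\<^bsub>R\<^esub> \<in> I"
    and add: "\<And>x y. x \<in> I \<Longrightarrow> y \<in> I \<Longrightarrow> x \<oplus>\<^bsub>R\<^esub> y \<in> I"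
    and mult: "\<And>r x. r \<in> carrier R \<Longrightarrow> x \<in> I \<Longrightarrow> r \<otimes>\<^bsub>R\<^esub> x \<in> I"
  shows "ideal I R"
proof -
  interpret cring R by fact
  show ?thesis
  proof (rule idealI)
    show "ring R" by (rule ring_axioms)
    show "subgroup I (add_monoid R)"
    proof (rule add.subgroupI)
      fix a assume a: "a \<in> I"
      then have "(\<ominus>\<^bsub>R\<^esub> \<one>\<^bsub>R\<^esub>) \<otimes>\<^bsub>R\<^esub> a \<in> I" using mult by simp
      moreover have "(\<ominus>\<^bsub>R\<^esub> \<one>\<^bsub>R\<^esub>) \<otimes>\<^bsub>R\<^esub> a = \<ominus>\<^bsub>R\<^esub> a" using a sub by (simp add: l_minus subsetD)
      ultimately show "\<ominus>\<^bsub>R\<^esub> a \<in> I" by simp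
    qed (use sub z add in auto)
    show "x \<otimes>\<^bsub>R\<^esub> a \<in> I" if "a \<in> I" "x \<in> carrier R" for a x using mult that by blast
    then show "a \<otimes>\<^bsub>R\<^esub> x \<in> I" if "a \<in> I" "x \<in> carrier R" for a x
      using that m_comm[of a x] sub by auto
  qed
qed

text \<open>
  The scalars \<open>r\<close> with \<open>r x\<close> in the domain form an ideal, on which \<open>r \<mapsto> G(r x)\<close> is linear. If it is
  \<open>r \<mapsto> r z\<close>, then \<open>z\<close> is a consistent value for \<open>x\<close>.
\<close>

lemma partial_lin_map_extend:
  assumes N: "Module.module R N" and E: "Module.module R E" and G: "partial_lin_map R N E G"
    and ext: "\<And>I h. ideal I R \<Longrightarrow> h \<in> lin_hom R (ideal_module R I) E \<Longrightarrow>
      \<exists>z\<in>carrier E. \<forall>r\<in>I. h r = r \<odot>\<^bsub>E\<^esub> z"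
    and x: "x \<in> carrier N"
  shows "\<exists>G'. partial_lin_map R N E G' \<and> G \<subseteq> G' \<and> x \<in> Domain G'"
proof -
  interpret N: Module.module R N by fact
  interpret E: Module.module R E by fact
  have Gc: "n \<in> carrier N" "e \<in> carrier E" if "(n, e) \<in> G" for n e
    using G that unfolding partial_lin_map_def by auto
  have G0: "(\<zero>\<^bsub>N\<^esub>, \<zero>\<^bsub>E\<^esub>) \<in> G"
    and Gadd: "\<And>n e m d. (n, e) \<in> G \<Longrightarrow> (m, d) \<in> G \<Longrightarrow> (n \<oplus>\<^bsub>N\<^esub> m, e \<oplus>\<^bsub>E\<^esub> d) \<in> G"
    and Gsm: "\<And>r n e. r \<in> carrier R \<Longrightarrow> (n, e) \<in> G \<Longrightarrow> (r \<odot>\<^bsub>N\<^esub> n, r \<odot>\<^bsub>E\<^esub> e) \<in> G"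
    using G unfolding partial_lin_map_def by blast+
  note uniq = partial_lin_map_unique[OF N E G]
  define I where "I = {r \<in> carrier R. \<exists>e. (r \<odot>\<^bsub>N\<^esub> x, e) \<in> G}"
  define h where "h r = (THE e. (r \<odot>\<^bsub>N\<^esub> x, e) \<in> G)" for r
  have h: "h r = e" if "(r \<odot>\<^bsub>N\<^esub> x, e) \<in> G" for r e
    unfolding h_def using that uniq by blast
  have hG: "(r \<odot>\<^bsub>N\<^esub> x, h r) \<in> G" if "r \<in> I" for r
    using that h unfolding I_def by auto
  have add: "((r \<oplus>\<^bsub>R\<^esub> s) \<odot>\<^bsub>N\<^esub> x, h r \<oplus>\<^bsub>E\<^esub> h s) \<in> G" if "r \<in> I" "s \<in> I" for r s
    using Gadd[OF hG[OF that(1)] hG[OF that(2)]] that x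
    unfolding I_def by (simp add: N.smult_l_distr)
  have sm: "((r \<otimes>\<^bsub>R\<^esub> s) \<odot>\<^bsub>N\<^esub> x, r \<odot>\<^bsub>E\<^esub> h s) \<in> G" if "r \<in> carrier R" "s \<in> I" for r s
    using Gsm[OF that(1) hG[OF that(2)]] that x
    unfolding I_def by (simp add: N.smult_assoc1)
  have "ideal I R"
  proof (rule cring_idealI)
    show "cring R" by (rule N.R.is_cring)
    show "I \<subseteq> carrier R" unfolding I_def by blast
    show "\<zero>\<^bsub>R\<^esub> \<in> I" unfolding I_def using x G0 by auto
    show "r \<oplus>\<^bsub>R\<^esub> s \<in> I" if "r \<in> I" "s \<in> I" for r s
      using add[OF that] that unfolding I_def by auto
    show "r \<otimes>\<^bsub>R\<^esub> s \<in> I" if "r \<in> carrier R" "s \<in> I" for r s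
      using sm[OF that] that unfolding I_def by auto
  qed
  moreover have "h \<in> lin_hom R (ideal_module R I) E"
    unfolding lin_hom_def ideal_module_def using hG Gc(2) h[OF add] h[OF sm] by auto
  ultimately obtain z where z: "z \<in> carrier E" "\<And>r. r \<in> I \<Longrightarrow> h r = r \<odot>\<^bsub>E\<^esub> z"
    using ext by blast
  define G' where "G' = {(n \<oplus>\<^bsub>N\<^esub> r \<odot>\<^bsub>N\<^esub> x, e \<oplus>\<^bsub>E\<^esub> r \<odot>\<^bsub>E\<^esub> z) | n e r. (n, e) \<in> G \<and> r \<in> carrier R}"
  have G'I: "(n \<oplus>\<^bsub>N\<^esub> r \<odot>\<^bsub>N\<^esub> x, e \<oplus>\<^bsub>E\<^esub> r \<odot>\<^bsub>E\<^esub> z) \<in> G'" if "(n, e) \<in> G" "r \<in> carrier R" for n e r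
    using that unfolding G'_def by blast
  have sub: "G \<subseteq> G'"
  proof
    fix p assume "p \<in> G"
    then obtain n e where p: "p = (n, e)" "(n, e) \<in> G" by (cases p) auto
    show "p \<in> G'" using G'I[OF p(2), of "\<zero>\<^bsub>R\<^esub>"] Gc[OF p(2)] p x z by simp
  qed
  have "(x, z) \<in> G'" using G'I[OF G0, of "\<one>\<^bsub>R\<^esub>"] x z by simp
  moreover have "partial_lin_map R N E G'"
    unfolding partial_lin_map_def
  proof (intro conjI allI ballI impI; (elim conjE)?)
    show "G' \<subseteq> carrier N \<times> carrier E" unfolding G'_def using Gc x z by auto
    show "(\<zero>\<^bsub>N\<^esub>, \<zero>\<^bsub>E\<^esub>) \<in> G'" using G0 sub by blast
  next
    fix m1 e1 m2 e2 assume "(m1, e1) \<in> G'" "(m2, e2) \<in> G'"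
    then obtain n d r n' d' r' where
      1: "m1 = n \<oplus>\<^bsub>N\<^esub> r \<odot>\<^bsub>N\<^esub> x" "e1 = d \<oplus>\<^bsub>E\<^esub> r \<odot>\<^bsub>E\<^esub> z" "(n, d) \<in> G" "r \<in> carrier R" and
      2: "m2 = n' \<oplus>\<^bsub>N\<^esub> r' \<odot>\<^bsub>N\<^esub> x" "e2 = d' \<oplus>\<^bsub>E\<^esub> r' \<odot>\<^bsub>E\<^esub> z" "(n', d') \<in> G" "r' \<in> carrier R"
      unfolding G'_def by blast
    note c = Gc[OF 1(3)] Gc[OF 2(3)] 1(4) 2(4) x z(1)
    have "m1 \<oplus>\<^bsub>N\<^esub> m2 = (n \<oplus>\<^bsub>N\<^esub> n') \<oplus>\<^bsub>N\<^esub> (r \<oplus>\<^bsub>R\<^esub> r') \<odot>\<^bsub>N\<^esub> x"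
      using c unfolding 1 2 by (simp add: N.smult_l_distr N.M.a_ac)
    moreover have "e1 \<oplus>\<^bsub>E\<^esub> e2 = (d \<oplus>\<^bsub>E\<^esub> d') \<oplus>\<^bsub>E\<^esub> (r \<oplus>\<^bsub>R\<^esub> r') \<odot>\<^bsub>E\<^esub> z"
      using c unfolding 1 2 by (simp add: E.smult_l_distr E.M.a_ac)
    ultimately show "(m1 \<oplus>\<^bsub>N\<^esub> m2, e1 \<oplus>\<^bsub>E\<^esub> e2) \<in> G'"
      using G'I[OF Gadd[OF 1(3) 2(3)]] 1(4) 2(4) by simp
  next
    fix s m e assume s: "s \<in> carrier R" and "(m, e) \<in> G'"
    then obtain n d r where
      1: "m = n \<oplus>\<^bsub>N\<^esub> r \<odot>\<^bsub>N\<^esub> x" "e = d \<oplus>\<^bsub>E\<^esub> r \<odot>\<^bsub>E\<^esub> z" "(n, d) \<in> G" "r \<in> carrier R"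
      unfolding G'_def by blast
    note c = Gc[OF 1(3)] 1(4) x z(1) s
    have "s \<odot>\<^bsub>N\<^esub> m = s \<odot>\<^bsub>N\<^esub> n \<oplus>\<^bsub>N\<^esub> (s \<otimes>\<^bsub>R\<^esub> r) \<odot>\<^bsub>N\<^esub> x"
      using c unfolding 1 by (simp add: N.smult_r_distr N.smult_assoc1)
    moreover have "s \<odot>\<^bsub>E\<^esub> e = s \<odot>\<^bsub>E\<^esub> d \<oplus>\<^bsub>E\<^esub> (s \<otimes>\<^bsub>R\<^esub> r) \<odot>\<^bsub>E\<^esub> z"
      using c unfolding 1 by (simp add: E.smult_r_distr E.smult_assoc1)
    ultimately show "(s \<odot>\<^bsub>N\<^esub> m, s \<odot>\<^bsub>E\<^esub> e) \<in> G'"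
      using G'I[OF Gsm[OF s 1(3)]] 1(4) s by simp
  next
    fix e assume "(\<zero>\<^bsub>N\<^esub>, e) \<in> G'"
    then obtain n d r where
      1: "\<zero>\<^bsub>N\<^esub> = n \<oplus>\<^bsub>N\<^esub> r \<odot>\<^bsub>N\<^esub> x" "e = d \<oplus>\<^bsub>E\<^esub> r \<odot>\<^bsub>E\<^esub> z" "(n, d) \<in> G" "r \<in> carrier R"
      unfolding G'_def by blast
    note c = Gc[OF 1(3)] 1(4) x z(1)
    have "(\<ominus>\<^bsub>R\<^esub> \<one>\<^bsub>R\<^esub>) \<odot>\<^bsub>N\<^esub> n = \<ominus>\<^bsub>N\<^esub> n" "(\<ominus>\<^bsub>R\<^esub> \<one>\<^bsub>R\<^esub>) \<odot>\<^bsub>E\<^esub> d = \<ominus>\<^bsub>E\<^esub> d"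
      using c by (simp_all add: N.smult_l_minus E.smult_l_minus)
    moreover have "\<ominus>\<^bsub>N\<^esub> n = r \<odot>\<^bsub>N\<^esub> x"
      using 1(1) c by (metis N.M.minus_equality N.M.a_comm N.smult_closed)
    ultimately have "(r \<odot>\<^bsub>N\<^esub> x, \<ominus>\<^bsub>E\<^esub> d) \<in> G" using Gsm[OF _ 1(3), of "\<ominus>\<^bsub>R\<^esub> \<one>\<^bsub>R\<^esub>"] by simp
    then have "r \<in> I" "h r = \<ominus>\<^bsub>E\<^esub> d" using c h unfolding I_def by auto
    then have "r \<odot>\<^bsub>E\<^esub> z = \<ominus>\<^bsub>E\<^esub> d" using z by simp
    then show "e = \<zero>\<^bsub>E\<^esub>" using c 1 by (simp add: E.M.r_neg)
  qed
  ultimately show ?thesis using sub by blast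
qed

text \<open>
  A maximal partial linear map extending \<open>f\<close> along the injection \<open>i\<close> is defined everywhere, by
  \<open>partial_lin_map_extend\<close>.
\<close>

theorem baer_criterion:
  assumes E: "Module.module R E"
    and ext: "\<And>I h. ideal I R \<Longrightarrow> h \<in> lin_hom R (ideal_module R I) E \<Longrightarrow>
      \<exists>z\<in>carrier E. \<forall>r\<in>I. h r = r \<odot>\<^bsub>E\<^esub> z"
  shows "injective_module TYPE('m) TYPE('n) R E"
  unfolding injective_module_def
proof (intro conjI allI impI; (elim conjE)?)
  show "Module.module R E" by (rule E)
  fix M :: "('a, 'm) module" and N :: "('a, 'n) module" and i f
  assume M: "Module.module R M" and N: "Module.module R N"
    and i: "i \<in> lin_hom R M N" and inj: "inj_on i (carrier M)" and f: "f \<in> lin_hom R M E"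
  interpret M: Module.module R M by fact
  interpret N: Module.module R N by fact
  interpret E: Module.module R E by fact
  define \<A> where "\<A> = {G. partial_lin_map R N E G \<and> (\<forall>x\<in>carrier M. (i x, f x) \<in> G)}"
  have "(\<lambda>x. (i x, f x)) ` carrier M \<in> \<A>"
  proof -
    let ?G = "(\<lambda>x. (i x, f x)) ` carrier M"
    have "partial_lin_map R N E ?G"
      unfolding partial_lin_map_def
    proof (intro conjI allI ballI impI; (elim conjE)?)
      show "?G \<subseteq> carrier N \<times> carrier E" using lin_homD(1)[OF i] lin_homD(1)[OF f] by auto
      show "(\<zero>\<^bsub>N\<^esub>, \<zero>\<^bsub>E\<^esub>) \<in> ?G"
        by (rule image_eqI[of _ _ "\<zero>\<^bsub>M\<^esub>"])
          (simp_all add: lin_hom_zero[OF M N i] lin_hom_zero[OF M E f])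
    next
      fix x e y d assume "(x, e) \<in> ?G" "(y, d) \<in> ?G"
      then obtain m m' where "m \<in> carrier M" "x = i m" "e = f m" "m' \<in> carrier M" "y = i m'" "d = f m'"
        by blast
      then show "(x \<oplus>\<^bsub>N\<^esub> y, e \<oplus>\<^bsub>E\<^esub> d) \<in> ?G"
        by (intro image_eqI[of _ _ "m \<oplus>\<^bsub>M\<^esub> m'"]) (simp_all add: lin_homD(2)[OF i] lin_homD(2)[OF f])
    next
      fix r x e assume r: "r \<in> carrier R" and "(x, e) \<in> ?G"
      then obtain m where "m \<in> carrier M" "x = i m" "e = f m" by blast
      with r show "(r \<odot>\<^bsub>N\<^esub> x, r \<odot>\<^bsub>E\<^esub> e) \<in> ?G"
        by (intro image_eqI[of _ _ "r \<odot>\<^bsub>M\<^esub> m"]) (simp_all add: lin_homD(3)[OF i] lin_homD(3)[OF f])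
    next
      fix e assume "(\<zero>\<^bsub>N\<^esub>, e) \<in> ?G"
      then obtain x where x: "x \<in> carrier M" "i x = \<zero>\<^bsub>N\<^esub>" "e = f x" by auto
      then have "x = \<zero>\<^bsub>M\<^esub>" using inj lin_hom_zero[OF M N i] by (metis M.M.zero_closed inj_onD)
      then show "e = \<zero>\<^bsub>E\<^esub>" using x lin_hom_zero[OF M E f] by simp
    qed
    then show ?thesis unfolding \<A>_def by blast
  qed
  then have "\<A> \<noteq> {}" by blast
  then have "\<exists>G\<in>\<A>. \<forall>G'\<in>\<A>. G \<subseteq> G' \<longrightarrow> G' = G"
  proof (rule subset_Zorn_nonempty)
    fix \<C> assume ne: "\<C> \<noteq> {}" and ch: "subset.chain \<A> \<C>"
    then have sub: "\<And>G. G \<in> \<C> \<Longrightarrow> G \<in> \<A>" and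
      lin: "\<And>G G'. G \<in> \<C> \<Longrightarrow> G' \<in> \<C> \<Longrightarrow> G \<subseteq> G' \<or> G' \<subseteq> G"
      unfolding subset.chain_def by (blast, fastforce)
    have "partial_lin_map R N E (\<Union>\<C>)"
      unfolding partial_lin_map_def
    proof (intro conjI allI ballI impI; (elim conjE)?)
      show "\<Union>\<C> \<subseteq> carrier N \<times> carrier E"
        using sub unfolding \<A>_def partial_lin_map_def by blast
      show "(\<zero>\<^bsub>N\<^esub>, \<zero>\<^bsub>E\<^esub>) \<in> \<Union>\<C>"
        using sub ne unfolding \<A>_def partial_lin_map_def by blast
    next
      fix x e y d assume "(x, e) \<in> \<Union>\<C>" "(y, d) \<in> \<Union>\<C>"
      then obtain G where "G \<in> \<C>" "(x, e) \<in> G" "(y, d) \<in> G" using lin by blast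
      then show "(x \<oplus>\<^bsub>N\<^esub> y, e \<oplus>\<^bsub>E\<^esub> d) \<in> \<Union>\<C>"
        using sub unfolding \<A>_def partial_lin_map_def by blast
    next
      fix r x e assume "r \<in> carrier R" "(x, e) \<in> \<Union>\<C>"
      then show "(r \<odot>\<^bsub>N\<^esub> x, r \<odot>\<^bsub>E\<^esub> e) \<in> \<Union>\<C>"
        using sub unfolding \<A>_def partial_lin_map_def by blast
    next
      fix e assume "(\<zero>\<^bsub>N\<^esub>, e) \<in> \<Union>\<C>"
      then show "e = \<zero>\<^bsub>E\<^esub>" using sub unfolding \<A>_def partial_lin_map_def by blast
    qed
    then show "\<Union>\<C> \<in> \<A>" using sub ne unfolding \<A>_def by blast
  qed
  then obtain G where "G \<in> \<A>" and max: "\<And>G'. G' \<in> \<A> \<Longrightarrow> G \<subseteq> G' \<Longrightarrow> G' = G"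
    by blast
  then have G: "partial_lin_map R N E G" and Gf: "\<And>x. x \<in> carrier M \<Longrightarrow> (i x, f x) \<in> G"
    unfolding \<A>_def by blast+
  note uniq = partial_lin_map_unique[OF N E G]
  have total: "\<exists>e. (x, e) \<in> G" if "x \<in> carrier N" for x
  proof -
    obtain G' where G': "partial_lin_map R N E G'" "G \<subseteq> G'" "x \<in> Domain G'"
      using partial_lin_map_extend[OF N E G ext \<open>x \<in> carrier N\<close>] by blast
    then have "G' \<in> \<A>" using Gf unfolding \<A>_def by blast
    then show ?thesis using max G' by blast
  qed
  define g where "g x = (THE e. (x, e) \<in> G)" for x
  have g: "g x = e" if "(x, e) \<in> G" for x e
    unfolding g_def using that uniq by blast
  have gG: "(x, g x) \<in> G" if "x \<in> carrier N" for x
    using total[OF that] g by auto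
  have "g \<in> lin_hom R N E"
    unfolding lin_hom_def
  proof (intro CollectI conjI ballI)
    show "g \<in> carrier N \<rightarrow> carrier E"
      using gG G unfolding partial_lin_map_def by blast
    show "g (x \<oplus>\<^bsub>N\<^esub> y) = g x \<oplus>\<^bsub>E\<^esub> g y" if "x \<in> carrier N" "y \<in> carrier N" for x y
      using gG[OF that(1)] gG[OF that(2)] G g unfolding partial_lin_map_def by blast
    show "g (r \<odot>\<^bsub>N\<^esub> x) = r \<odot>\<^bsub>E\<^esub> g x" if "r \<in> carrier R" "x \<in> carrier N" for r x
      using gG[OF that(2)] that(1) G g unfolding partial_lin_map_def by blast
  qed
  moreover have "\<forall>x\<in>carrier M. g (i x) = f x" using Gf g by blast
  ultimately show "\<exists>g\<in>lin_hom R N E. \<forall>x\<in>carrier M. g (i x) = f x"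
    by (intro bexI[of _ g])
qed

section \<open>The convolution ring\<close>

locale root_series_field = field K for K :: "('k, 'c) ring_scheme" (structure)
begin

abbreviation P :: "(real \<Rightarrow> 'k) ring"
  where "P \<equiv> root_series_ring K"

text \<open>
  Series are \<^const>\<open>undefined\<close> outside \<open>[0,1]\<close>. Extension by zero allows convolution sums to range over
  any sufficiently large finite set of reals, with no side conditions on the indices.
\<close>

definition coefficient :: "(real \<Rightarrow> 'k) \<Rightarrow> real \<Rightarrow> 'k"
  where "coefficient a x = (if x \<in> {0..1} then a x else \<zero>)"

lemma mem_P_iff: "a \<in> carrier P \<longleftrightarrow> a \<in> {0..1} \<rightarrow>\<^sub>E carrier K \<and> well_ordered (supp K a)"
  by (simp add: root_series_ring_def root_series_def well_ordered_def)

lemma carrier_P: "carrier P = root_series K"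
  by (simp add: root_series_ring_def)

lemma value_closed [simp, intro]: "a \<in> carrier P \<Longrightarrow> x \<in> {0..1} \<Longrightarrow> a x \<in> carrier K"
  by (auto simp: mem_P_iff)

lemma well_ordered_supp: "a \<in> carrier P \<Longrightarrow> well_ordered (supp K a)"
  by (simp add: mem_P_iff)

lemma coefficient_closed [simp, intro]: "a \<in> carrier P \<Longrightarrow> coefficient a x \<in> carrier K"
  by (auto simp: coefficient_def)

lemma coefficient_eq [simp]: "x \<in> {0..1} \<Longrightarrow> coefficient a x = a x"
  by (simp add: coefficient_def)

lemma supp_iff: "x \<in> supp K a \<longleftrightarrow> coefficient a x \<noteq> \<zero>"
  by (auto simp: supp_def coefficient_def)

lemma supp_bounds: "x \<in> supp K a \<Longrightarrow> 0 \<le> x \<and> x \<le> 1"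
  by (simp add: supp_def)

lemma P_eqI:
  assumes "a \<in> carrier P" "b \<in> carrier P" "\<And>q. q \<in> {0..1} \<Longrightarrow> a q = b q"
  shows "a = b"
  using assms by (auto simp: mem_P_iff intro: PiE_ext)

lemma restrict_mem_P:
  assumes "\<And>x. x \<in> {0..1} \<Longrightarrow> f x \<in> carrier K"
    and "well_ordered {x\<in>{0..1}. f x \<noteq> \<zero>}"
  shows "(\<lambda>x\<in>{0..1}. f x) \<in> carrier P"
proof -
  have "supp K (\<lambda>x\<in>{0..1}. f x) = {x\<in>{0..1}. f x \<noteq> \<zero>}" by (auto simp: supp_def)
  then show ?thesis using assms by (auto simp: mem_P_iff)
qed

lemma add_P: "q \<in> {0..1} \<Longrightarrow> (a \<oplus>\<^bsub>P\<^esub> b) q = a q \<oplus> b q"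
  and zero_P: "q \<in> {0..1} \<Longrightarrow> \<zero>\<^bsub>P\<^esub> q = \<zero>"
  and mult_P: "a \<otimes>\<^bsub>P\<^esub> b = conv K a b"
  and one_P: "\<one>\<^bsub>P\<^esub> = const_series K \<one>"
  by (simp_all add: root_series_ring_def)

lemma add_P_closed:
  assumes "a \<in> carrier P" "b \<in> carrier P"
  shows "a \<oplus>\<^bsub>P\<^esub> b \<in> carrier P"
proof -
  have "(\<lambda>x\<in>{0..1}. a x \<oplus> b x) \<in> carrier P"
  proof (rule restrict_mem_P)
    show "well_ordered {x \<in> {0..1}. a x \<oplus> b x \<noteq> \<zero>}"
      by (rule well_ordered_subset[OF well_ordered_Un[OF assms[THEN well_ordered_supp]]])
        (auto simp: supp_def)
  qed (use assms in auto)
  then show ?thesis by (simp add: root_series_ring_def)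
qed

lemma zero_P_closed: "\<zero>\<^bsub>P\<^esub> \<in> carrier P"
  using restrict_mem_P[of "\<lambda>_. \<zero>"] well_ordered_subset[OF well_ordered_singleton, of "{}"]
  by (simp add: root_series_ring_def)

lemma uminus_P:
  assumes "a \<in> carrier P"
  shows "\<exists>b\<in>carrier P. b \<oplus>\<^bsub>P\<^esub> a = \<zero>\<^bsub>P\<^esub>"
proof (rule bexI)
  show "(\<lambda>x\<in>{0..1}. \<ominus> a x) \<in> carrier P"
  proof (rule restrict_mem_P)
    show "well_ordered {x \<in> {0..1}. \<ominus> a x \<noteq> \<zero>}"
      by (rule well_ordered_subset[OF well_ordered_supp[OF assms]]) (auto simp: supp_def)
  qed (use assms in auto)
  then show "(\<lambda>x\<in>{0..1}. \<ominus> a x) \<oplus>\<^bsub>P\<^esub> a = \<zero>\<^bsub>P\<^esub>"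
    using assms by (intro P_eqI add_P_closed zero_P_closed) (auto simp: add_P zero_P l_neg)
qed

lemma conv_supp_eq:
  assumes "a \<in> carrier P" "b \<in> carrier P" "q \<in> {0..1}"
  shows "conv_supp K a b q = {x \<in> supp K a. q - x \<in> supp K b}"
proof -
  have "a x \<otimes> b (q - x) \<noteq> \<zero> \<longleftrightarrow> a x \<noteq> \<zero> \<and> b (q - x) \<noteq> \<zero>" if "x \<in> {0..q}" for x
    using that assms value_closed[of a x] value_closed[of b "q - x"]
    by (simp add: integral_iff)
  then show ?thesis using assms(3) by (auto simp: conv_supp_def supp_def)
qed

lemma finite_conv_supp:
  assumes "a \<in> carrier P" "b \<in> carrier P" "q \<in> {0..1}"
  shows "finite (conv_supp K a b q)"
  unfolding conv_supp_eq[OF assms]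
  by (intro finite_antidiagonal well_ordered_supp assms)

text \<open>
  Sums for different products, or for different exponents, are compared by taking them over a
  common index set \<open>F\<close>.
\<close>

lemma conv_eq_finsum:
  assumes "a \<in> carrier P" "b \<in> carrier P" "q \<in> {0..1}"
    and F: "finite F" "conv_supp K a b q \<subseteq> F"
  shows "conv K a b q = (\<Oplus>r\<in>F. coefficient a r \<otimes> coefficient b (q - r))"
proof -
  have "(\<Oplus>r\<in>conv_supp K a b q. a r \<otimes> b (q - r))
      = (\<Oplus>r\<in>F. coefficient a r \<otimes> coefficient b (q - r))"
  proof (rule add.finprod_mono_neutral_cong_left[OF F])
    fix r assume "r \<in> F - conv_supp K a b q"
    then show "coefficient a r \<otimes> coefficient b (q - r) = \<zero>"
      using assms by (auto simp: conv_supp_eq supp_iff)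
  next
    fix r assume "r \<in> conv_supp K a b q"
    then show "a r \<otimes> b (q - r) = coefficient a r \<otimes> coefficient b (q - r)"
      using assms(3) by (auto simp: conv_supp_def)
  qed (use assms in auto)
  then show ?thesis using assms(3) by (simp add: conv_def)
qed

lemma conv_zero_if_conv_supp_empty:
  assumes "a \<in> carrier P" "b \<in> carrier P" "q \<in> {0..1}" "conv_supp K a b q = {}"
  shows "conv K a b q = \<zero>"
  using assms by (simp add: conv_def)

lemma conv_nonzero:
  assumes "a \<in> carrier P" "b \<in> carrier P" "q \<in> {0..1}" "conv K a b q \<noteq> \<zero>"
  obtains x where "x \<in> supp K a" "q - x \<in> supp K b"
  using conv_zero_if_conv_supp_empty[OF assms(1-3)] assms(4) conv_supp_eq[OF assms(1-3)] by blast

lemma supp_conv: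
  assumes "a \<in> carrier P" "b \<in> carrier P"
  shows "supp K (conv K a b) \<subseteq> {z. \<exists>x\<in>supp K a. \<exists>y\<in>supp K b. z = x + y}"
proof
  fix z assume "z \<in> supp K (conv K a b)"
  then have "z \<in> {0..1}" "conv K a b z \<noteq> \<zero>" by (auto simp: supp_def)
  then obtain x where "x \<in> supp K a" "z - x \<in> supp K b" using conv_nonzero[OF assms] by blast
  then show "z \<in> {z. \<exists>x\<in>supp K a. \<exists>y\<in>supp K b. z = x + y}"
    by (intro CollectI bexI[of _ x] bexI[of _ "z - x"]) auto
qed

lemma conv_closed:
  assumes "a \<in> carrier P" "b \<in> carrier P"
  shows "conv K a b \<in> carrier P"
  unfolding mem_P_iff
proof
  show "well_ordered (supp K (conv K a b))"
    by (rule well_ordered_subset[OF well_ordered_sum[OF assms[THEN well_ordered_supp]] supp_conv[OF assms]])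
  have "conv K a b q \<in> carrier K" if "q \<in> {0..1}" for q
    using conv_eq_finsum[OF assms that finite_conv_supp[OF assms that] subset_refl] assms by auto
  then show "conv K a b \<in> {0..1} \<rightarrow>\<^sub>E carrier K" by (simp add: conv_def PiE_iff)
qed

lemma conv_comm:
  assumes "a \<in> carrier P" "b \<in> carrier P"
  shows "conv K a b = conv K b a"
proof (rule P_eqI)
  fix q :: real assume q: "q \<in> {0..1}"
  let ?F = "conv_supp K a b q"
  have "conv_supp K b a q \<subseteq> (\<lambda>r. q - r) ` ?F"
  proof
    fix x assume "x \<in> conv_supp K b a q"
    then show "x \<in> (\<lambda>r. q - r) ` ?F"
      using assms q by (intro image_eqI[of _ _ "q - x"]) (auto simp: conv_supp_eq)
  qed
  then have "conv K b a q = (\<Oplus>r\<in>(\<lambda>r. q - r) ` ?F. coefficient b r \<otimes> coefficient a (q - r))"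
    using assms q by (intro conv_eq_finsum finite_imageI finite_conv_supp) auto
  also have "\<dots> = (\<Oplus>r\<in>?F. coefficient b (q - r) \<otimes> coefficient a (q - (q - r)))"
    using assms by (intro finsum_reindex) (auto simp: inj_on_def)
  also have "\<dots> = (\<Oplus>r\<in>?F. coefficient a r \<otimes> coefficient b (q - r))"
    using assms by (intro finsum_cong') (auto simp: m_comm)
  also have "\<dots> = conv K a b q"
    using assms q by (intro conv_eq_finsum[symmetric] finite_conv_supp) auto
  finally show "conv K a b q = conv K b a q" by simp
qed (use assms in \<open>auto intro: conv_closed\<close>)

lemma conv_distrib:
  assumes "a \<in> carrier P" "b \<in> carrier P" "c \<in> carrier P"
  shows "conv K (a \<oplus>\<^bsub>P\<^esub> b) c = conv K a c \<oplus>\<^bsub>P\<^esub> conv K b c"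
proof (rule P_eqI)
  note ab = add_P_closed[OF assms(1,2)]
  fix q :: real assume q: "q \<in> {0..1}"
  define F where "F = conv_supp K (a \<oplus>\<^bsub>P\<^esub> b) c q \<union> conv_supp K a c q \<union> conv_supp K b c q"
  have F: "finite F" unfolding F_def using assms ab q by (auto intro: finite_conv_supp)
  have coeff: "coefficient (a \<oplus>\<^bsub>P\<^esub> b) r = coefficient a r \<oplus> coefficient b r" for r
    by (simp add: coefficient_def add_P)
  have "conv K (a \<oplus>\<^bsub>P\<^esub> b) c q = (\<Oplus>r\<in>F. coefficient (a \<oplus>\<^bsub>P\<^esub> b) r \<otimes> coefficient c (q - r))"
    using assms ab q F by (intro conv_eq_finsum) (auto simp: F_def)
  also have "\<dots> = (\<Oplus>r\<in>F. coefficient a r \<otimes> coefficient c (q - r)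
      \<oplus> coefficient b r \<otimes> coefficient c (q - r))"
    using assms by (intro finsum_cong') (auto simp: coeff l_distr)
  also have "\<dots> = (\<Oplus>r\<in>F. coefficient a r \<otimes> coefficient c (q - r))
      \<oplus> (\<Oplus>r\<in>F. coefficient b r \<otimes> coefficient c (q - r))"
    using assms by (intro finsum_addf) auto
  also have "\<dots> = conv K a c q \<oplus> conv K b c q"
    using assms q F by (intro arg_cong2[where f = "(\<oplus>)"] conv_eq_finsum[symmetric]) (auto simp: F_def)
  finally show "conv K (a \<oplus>\<^bsub>P\<^esub> b) c q = (conv K a c \<oplus>\<^bsub>P\<^esub> conv K b c) q"
    using q by (simp add: add_P)
qed (use assms in \<open>auto intro!: conv_closed add_P_closed\<close>)

lemma finsum_swap:
  assumes "finite F" "finite G" "\<And>r s. r \<in> F \<Longrightarrow> s \<in> G \<Longrightarrow> f r s \<in> carrier K"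
  shows "(\<Oplus>r\<in>F. \<Oplus>s\<in>G. f r s) = (\<Oplus>s\<in>G. \<Oplus>r\<in>F. f r s)"
  using assms(1,3)
proof (induction F)
  case empty
  then show ?case by simp
next
  case (insert r F)
  have "(\<Oplus>r\<in>insert r F. \<Oplus>s\<in>G. f r s) = (\<Oplus>s\<in>G. f r s) \<oplus> (\<Oplus>s\<in>G. \<Oplus>r\<in>F. f r s)"
    using insert assms(2) by (subst finsum_insert) auto
  also have "\<dots> = (\<Oplus>s\<in>G. f r s \<oplus> (\<Oplus>r\<in>F. f r s))"
    using insert.prems by (intro finsum_addf[symmetric]) (auto intro!: finsum_closed)
  also have "\<dots> = (\<Oplus>s\<in>G. \<Oplus>r\<in>insert r F. f r s)"
    using insert by (intro finsum_cong') (auto intro!: finsum_insert[symmetric] a_closed finsum_closed)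
  finally show ?case .
qed

text \<open>
  \<open>F\<close> collects the exponents \<open>x + y\<close> and \<open>G\<close> the exponents \<open>x\<close> that occur in triples \<open>(x, y, z)\<close> of exponents
  of \<open>a\<close>, \<open>b\<close>, \<open>c\<close> with sum \<open>q\<close>. Both sides are then the same double sum over \<open>F\<close> and \<open>G\<close>, in different
  order.
\<close>

lemma conv_assoc:
  assumes a: "a \<in> carrier P" and b: "b \<in> carrier P" and c: "c \<in> carrier P"
  shows "conv K (conv K a b) c = conv K a (conv K b c)"
proof (rule P_eqI)
  note ab = conv_closed[OF a b] and bc = conv_closed[OF b c]
  fix q :: real assume q: "q \<in> {0..1}"
  define F where "F = {r \<in> {z. \<exists>x\<in>supp K a. \<exists>y\<in>supp K b. z = x + y}. q - r \<in> supp K c}"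
  define G where "G = {s \<in> supp K a. q - s \<in> {z. \<exists>x\<in>supp K b. \<exists>y\<in>supp K c. z = x + y}}"
  have fin: "finite F" "finite G"
    unfolding F_def G_def by (intro finite_antidiagonal well_ordered_sum well_ordered_supp a b c)+
  let ?t = "\<lambda>r s. coefficient a s \<otimes> coefficient b (r - s) \<otimes> coefficient c (q - r)"
  have F01: "r \<in> {0..1}" if "r \<in> F" for r
  proof -
    from that obtain x y where "x \<in> supp K a" "y \<in> supp K b" "r = x + y" "q - r \<in> supp K c"
      unfolding F_def by blast
    then show ?thesis
      using supp_bounds[of x a] supp_bounds[of y b] supp_bounds[of "q - r" c] q by auto
  qed
  have G01: "q - s \<in> {0..1}" if "s \<in> G" for s
  proof -
    from that obtain x y where "x \<in> supp K b" "y \<in> supp K c" "q - s = x + y" "s \<in> supp K a"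
      unfolding G_def by blast
    then show ?thesis
      using supp_bounds[of x b] supp_bounds[of y c] supp_bounds[of s a] q by auto
  qed
  have inner1: "conv K a b r = (\<Oplus>s\<in>G. coefficient a s \<otimes> coefficient b (r - s))" if "r \<in> F" for r
  proof (rule conv_eq_finsum[OF a b _ fin(2)])
    show r: "r \<in> {0..1}" using that by (rule F01)
    show "conv_supp K a b r \<subseteq> G"
    proof
      fix s assume "s \<in> conv_supp K a b r"
      then have "s \<in> supp K a" "r - s \<in> supp K b" by (auto simp: conv_supp_eq[OF a b r])
      moreover have "q - r \<in> supp K c" using that by (simp add: F_def)
      moreover have "q - s = (r - s) + (q - r)" by simp
      ultimately show "s \<in> G" unfolding G_def by blast
    qed
  qed
  have inner2: "conv K b c (q - s) = (\<Oplus>r\<in>F. coefficient b (r - s) \<otimes> coefficient c (q - r))"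
    if "s \<in> G" for s
  proof -
    have qs: "q - s \<in> {0..1}" using that by (rule G01)
    have "conv K b c (q - s)
        = (\<Oplus>r\<in>(\<lambda>r. r - s) ` F. coefficient b r \<otimes> coefficient c (q - s - r))"
    proof (rule conv_eq_finsum[OF b c qs])
      show "finite ((\<lambda>r. r - s) ` F)" using fin by simp
      show "conv_supp K b c (q - s) \<subseteq> (\<lambda>r. r - s) ` F"
      proof
        fix u assume "u \<in> conv_supp K b c (q - s)"
        then have "u \<in> supp K b" "q - s - u \<in> supp K c" by (auto simp: conv_supp_eq[OF b c qs])
        moreover have "s \<in> supp K a" using that by (simp add: G_def)
        moreover have "q - s - u = q - (s + u)" by simp
        ultimately have "s + u \<in> F" unfolding F_def by auto
        then show "u \<in> (\<lambda>r. r - s) ` F" by (rule rev_image_eqI) simp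
      qed
    qed
    also have "\<dots> = (\<Oplus>r\<in>F. coefficient b (r - s) \<otimes> coefficient c (q - s - (r - s)))"
      using b c by (intro finsum_reindex) (auto simp: inj_on_def)
    finally show ?thesis by simp
  qed
  have "conv K (conv K a b) c q = (\<Oplus>r\<in>F. coefficient (conv K a b) r \<otimes> coefficient c (q - r))"
  proof (rule conv_eq_finsum[OF ab c q fin(1)])
    show "conv_supp K (conv K a b) c q \<subseteq> F"
      unfolding conv_supp_eq[OF ab c q] F_def using supp_conv[OF a b] by blast
  qed
  also have "\<dots> = (\<Oplus>r\<in>F. \<Oplus>s\<in>G. ?t r s)"
  proof (intro finsum_cong' refl)
    fix r assume r: "r \<in> F"
    then have "r \<in> {0..1}" by (rule F01)
    then have "coefficient (conv K a b) r \<otimes> coefficient c (q - r)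
        = (\<Oplus>s\<in>G. coefficient a s \<otimes> coefficient b (r - s)) \<otimes> coefficient c (q - r)"
      using inner1[OF r] by simp
    also have "\<dots> = (\<Oplus>s\<in>G. ?t r s)"
      using a b c fin by (intro finsum_ldistr) auto
    finally show "coefficient (conv K a b) r \<otimes> coefficient c (q - r) = (\<Oplus>s\<in>G. ?t r s)" .
  qed (use a b c in \<open>auto intro!: finsum_closed\<close>)
  also have "\<dots> = (\<Oplus>s\<in>G. \<Oplus>r\<in>F. ?t r s)"
    using a b c fin by (intro finsum_swap) auto
  also have "\<dots> = (\<Oplus>s\<in>G. coefficient a s \<otimes> coefficient (conv K b c) (q - s))"
  proof (intro finsum_cong' refl)
    fix s assume s: "s \<in> G"
    then have "q - s \<in> {0..1}" by (rule G01)
    then have "coefficient a s \<otimes> coefficient (conv K b c) (q - s)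
        = coefficient a s \<otimes> (\<Oplus>r\<in>F. coefficient b (r - s) \<otimes> coefficient c (q - r))"
      using inner2[OF s] by simp
    also have "\<dots> = (\<Oplus>r\<in>F. coefficient a s \<otimes> (coefficient b (r - s) \<otimes> coefficient c (q - r)))"
      using a b c fin by (intro finsum_rdistr) auto
    also have "\<dots> = (\<Oplus>r\<in>F. ?t r s)"
      using a b c by (intro finsum_cong') (auto simp: m_assoc)
    finally show "(\<Oplus>r\<in>F. ?t r s) = coefficient a s \<otimes> coefficient (conv K b c) (q - s)" by simp
  qed (use a bc in auto)
  also have "\<dots> = conv K a (conv K b c) q"
  proof (rule conv_eq_finsum[OF a bc q fin(2), symmetric])
    show "conv_supp K a (conv K b c) q \<subseteq> G"
      unfolding conv_supp_eq[OF a bc q] G_def using supp_conv[OF b c] by blast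
  qed
  finally show "conv K (conv K a b) c q = conv K a (conv K b c) q" .
qed (use assms in \<open>auto intro!: conv_closed\<close>)

definition monomial :: "'k \<Rightarrow> real \<Rightarrow> real \<Rightarrow> 'k"
  where "monomial k u = (\<lambda>x\<in>{0..1}. if x = u then k else \<zero>)"

lemma monomial_closed [simp, intro]: "k \<in> carrier K \<Longrightarrow> monomial k u \<in> carrier P"
  unfolding monomial_def
  by (rule restrict_mem_P) (auto intro: well_ordered_subset[OF well_ordered_singleton[of u]])

lemma monomial_apply: "x \<in> {0..1} \<Longrightarrow> monomial k u x = (if x = u then k else \<zero>)"
  by (simp add: monomial_def)

lemma supp_monomial: "supp K (monomial k u) \<subseteq> {u}"
  by (auto simp: supp_def monomial_def)

lemma const_series_eq_monomial: "const_series K k = monomial k 0"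
  by (simp add: const_series_def monomial_def)

lemma conv_monomial:
  assumes k: "k \<in> carrier K" and u: "u \<in> {0..1}" and b: "b \<in> carrier P" and q: "q \<in> {0..1}"
  shows "conv K (monomial k u) b q = k \<otimes> coefficient b (q - u)"
proof -
  have "conv K (monomial k u) b q = (\<Oplus>r\<in>{u}. coefficient (monomial k u) r \<otimes> coefficient b (q - r))"
    using k b q supp_monomial by (intro conv_eq_finsum) (auto simp: conv_supp_eq)
  then show ?thesis using u k b by (simp add: monomial_apply)
qed

lemma cring_P: "cring P"
proof (rule cringI)
  show "abelian_group P"
  proof (rule abelian_groupI)
    fix x y z assume "x \<in> carrier P" "y \<in> carrier P" "z \<in> carrier P"
    then show "x \<oplus>\<^bsub>P\<^esub> y \<oplus>\<^bsub>P\<^esub> z = x \<oplus>\<^bsub>P\<^esub> (y \<oplus>\<^bsub>P\<^esub> z)"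
      by (intro P_eqI add_P_closed) (auto simp: add_P a_assoc)
  next
    fix x y assume "x \<in> carrier P" "y \<in> carrier P"
    then show "x \<oplus>\<^bsub>P\<^esub> y = y \<oplus>\<^bsub>P\<^esub> x"
      by (intro P_eqI add_P_closed) (auto simp: add_P a_comm)
  next
    fix x assume "x \<in> carrier P"
    then show "\<zero>\<^bsub>P\<^esub> \<oplus>\<^bsub>P\<^esub> x = x"
      by (intro P_eqI add_P_closed zero_P_closed) (auto simp: add_P zero_P)
  qed (use add_P_closed zero_P_closed uminus_P in auto)
  show "comm_monoid P"
  proof (rule comm_monoidI)
    fix x assume x: "x \<in> carrier P"
    show "\<one>\<^bsub>P\<^esub> \<otimes>\<^bsub>P\<^esub> x = x"
      unfolding mult_P one_P const_series_eq_monomial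
      using x by (intro P_eqI conv_closed) (auto simp: conv_monomial)
  qed (auto simp: mult_P one_P const_series_eq_monomial conv_assoc intro: conv_closed conv_comm)
  show "(x \<oplus>\<^bsub>P\<^esub> y) \<otimes>\<^bsub>P\<^esub> z = x \<otimes>\<^bsub>P\<^esub> z \<oplus>\<^bsub>P\<^esub> y \<otimes>\<^bsub>P\<^esub> z"
    if "x \<in> carrier P" "y \<in> carrier P" "z \<in> carrier P" for x y z
    unfolding mult_P using that by (rule conv_distrib)
qed

sublocale P: cring P
  by (rule cring_P)

end

section \<open>Divisibility in the ring of root series\<close>

lemma well_ordered_shift:
  fixes A :: "real set"
  assumes "well_ordered A"
  shows "well_ordered {x. x + u \<in> A}"
  by (rule well_ordered_subset[OF well_ordered_sum[OF assms well_ordered_singleton[of "- u"]]]) force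

text \<open>
  The partial sums \<open>s\<close> of the geometric series satisfy \<open>(1 - x) s = 1 - x\<^sup>m\<close>.
\<close>

lemma (in cring) one_minus_nilpotent_invertible:
  assumes x: "x \<in> carrier R" and n: "x [^] (n::nat) = \<zero>"
  shows "\<exists>s\<in>carrier R. (\<one> \<ominus> x) \<otimes> s = \<one>"
proof -
  have "\<exists>s\<in>carrier R. (\<one> \<ominus> x) \<otimes> s = \<one> \<ominus> x [^] m" for m :: nat
  proof (induction m)
    case 0
    show ?case by (rule bexI[of _ \<zero>]) (use x in \<open>simp_all add: minus_eq r_neg\<close>)
  next
    case (Suc m)
    then obtain s where s: "s \<in> carrier R" "(\<one> \<ominus> x) \<otimes> s = \<one> \<ominus> x [^] m" by blast
    define y where "y = x [^] m"
    have y: "y \<in> carrier R" unfolding y_def using x by simp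
    have "(\<one> \<ominus> x) \<otimes> (s \<oplus> y) = (\<one> \<ominus> y) \<oplus> (\<one> \<ominus> x) \<otimes> y"
      using s x y by (simp add: r_distr y_def)
    also have "\<dots> = \<one> \<ominus> y \<otimes> x" using x y by algebra
    finally show ?case using s(1) y by (intro bexI[of _ "s \<oplus> y"]) (simp_all add: y_def)
  qed
  from this[of n] show ?thesis using n by (simp add: minus_eq)
qed

context root_series_field
begin

abbreviation t :: "real \<Rightarrow> real \<Rightarrow> 'k"
  where "t u \<equiv> monomial \<one> u"

lemma supp_empty_imp_zero: "a \<in> carrier P \<Longrightarrow> supp K a = {} \<Longrightarrow> a = \<zero>\<^bsub>P\<^esub>"
  by (rule P_eqI) (auto simp: zero_P supp_def)

lemma supp_zero: "supp K \<zero>\<^bsub>P\<^esub> = {}"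
  by (auto simp: supp_def zero_P)

lemma least_exponent:
  assumes "a \<in> carrier P" "a \<noteq> \<zero>\<^bsub>P\<^esub>"
  obtains u where "u \<in> supp K a" "supp K a \<subseteq> {u..}"
proof -
  obtain x where "x \<in> supp K a" using supp_empty_imp_zero assms by blast
  then obtain u where "u \<in> supp K a" "\<forall>s\<in>supp K a. u \<le> s"
    using well_orderedD[OF well_ordered_supp[OF assms(1)] subset_refl] by blast
  then show thesis by (intro that) auto
qed

lemma supp_mult_lower:
  assumes "a \<in> carrier P" "b \<in> carrier P" "supp K a \<subseteq> {u..}" "supp K b \<subseteq> {v..}"
  shows "supp K (a \<otimes>\<^bsub>P\<^esub> b) \<subseteq> {u + v..}"
  using supp_conv[OF assms(1,2)] assms(3,4) unfolding mult_P by fastforce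

text \<open>
  At most the pair \<open>(u, v)\<close> of exponents has the sum \<open>u + v\<close>.
\<close>

lemma mult_lowest:
  assumes a: "a \<in> carrier P" and b: "b \<in> carrier P"
    and u: "supp K a \<subseteq> {u..}" and v: "supp K b \<subseteq> {v..}"
    and uv: "0 \<le> u" "0 \<le> v" "u + v \<le> 1"
  shows "(a \<otimes>\<^bsub>P\<^esub> b) (u + v) = a u \<otimes> b v"
proof -
  have q: "u + v \<in> {0..1}" using uv by simp
  have "conv_supp K a b (u + v) \<subseteq> {u}"
    unfolding conv_supp_eq[OF a b q] using u v by fastforce
  then have "(a \<otimes>\<^bsub>P\<^esub> b) (u + v) = (\<Oplus>r\<in>{u}. coefficient a r \<otimes> coefficient b (u + v - r))"
    unfolding mult_P by (intro conv_eq_finsum[OF a b q]) auto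
  then show ?thesis using a b uv by simp
qed

lemma mult_at_zero:
  assumes "a \<in> carrier P" "b \<in> carrier P"
  shows "(a \<otimes>\<^bsub>P\<^esub> b) 0 = a 0 \<otimes> b 0"
  using mult_lowest[OF assms, of 0 0] by (auto simp: supp_def)

lemma t_mult_apply:
  assumes "u \<in> {0..1}" "b \<in> carrier P" "q \<in> {0..1}"
  shows "(t u \<otimes>\<^bsub>P\<^esub> b) q = coefficient b (q - u)"
  using assms conv_monomial[of \<one> u b q] by (simp add: mult_P)

lemma t_mult:
  assumes "0 \<le> u" "0 \<le> v" "u + v \<le> 1"
  shows "t u \<otimes>\<^bsub>P\<^esub> t v = t (u + v)"
proof (rule P_eqI)
  fix q :: real assume "q \<in> {0..1}"
  then show "(t u \<otimes>\<^bsub>P\<^esub> t v) q = t (u + v) q"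
    using assms by (auto simp: t_mult_apply coefficient_def monomial_apply)
qed auto

lemma mult_zero_if_exponents_exceed:
  assumes "a \<in> carrier P" "b \<in> carrier P" "supp K a \<subseteq> {u..}" "supp K b \<subseteq> {v..}" "u + v > 1"
  shows "a \<otimes>\<^bsub>P\<^esub> b = \<zero>\<^bsub>P\<^esub>"
proof (rule supp_empty_imp_zero)
  show "supp K (a \<otimes>\<^bsub>P\<^esub> b) = {}"
    using supp_mult_lower[OF assms(1-4)] assms(5) by (force simp: supp_def)
qed (use assms in auto)

lemma t_dvd_if_exponents_ge:
  assumes a: "a \<in> carrier P" and u: "u \<in> {0..1}" "supp K a \<subseteq> {u..}"
  obtains w where "w \<in> carrier P" "a = t u \<otimes>\<^bsub>P\<^esub> w" "w 0 = a u"
proof -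
  define w where "w = (\<lambda>x\<in>{0..1}. coefficient a (x + u))"
  have w: "w \<in> carrier P"
    unfolding w_def
  proof (rule restrict_mem_P)
    show "well_ordered {x \<in> {0..1}. coefficient a (x + u) \<noteq> \<zero>}"
      by (rule well_ordered_subset[OF well_ordered_shift[OF well_ordered_supp[OF a], of u]])
        (auto simp: supp_iff)
  qed (use a in auto)
  have "a = t u \<otimes>\<^bsub>P\<^esub> w"
  proof (rule P_eqI)
    fix q :: real assume q: "q \<in> {0..1}"
    have "a q = \<zero>" if "q < u" using that u(2) q by (force simp: supp_def)
    then show "a q = (t u \<otimes>\<^bsub>P\<^esub> w) q"
      using q u w by (auto simp: t_mult_apply coefficient_def w_def)
  qed (use a w in auto)
  moreover have "w 0 = a u" using u by (simp add: w_def)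
  ultimately show thesis using w that by blast
qed

lemma nilpotent_if_constant_term_zero:
  assumes b: "b \<in> carrier P" "b 0 = \<zero>"
  shows "\<exists>n::nat. b [^]\<^bsub>P\<^esub> n = \<zero>\<^bsub>P\<^esub>"
proof (cases "b = \<zero>\<^bsub>P\<^esub>")
  case True
  then have "b [^]\<^bsub>P\<^esub> (1::nat) = \<zero>\<^bsub>P\<^esub>" by simp
  then show ?thesis by blast
next
  case False
  then obtain u where u: "u \<in> supp K b" "supp K b \<subseteq> {u..}" using least_exponent b by blast
  then have "u \<ge> 0" "u \<noteq> 0" using b by (auto simp: supp_def)
  then have "u > 0" by simp
  have pow: "supp K (b [^]\<^bsub>P\<^esub> n) \<subseteq> {real n * u..}" for n :: nat
  proof (induction n)
    case 0
    show ?case by (auto simp: supp_def)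
  next
    case (Suc n)
    show ?case using supp_mult_lower[OF _ b(1) Suc u(2)] b by (simp add: algebra_simps)
  qed
  obtain n :: nat where "1 < real n * u" using \<open>u > 0\<close> ex_less_of_nat_mult by blast
  then have "supp K (b [^]\<^bsub>P\<^esub> n) = {}" using pow[of n] by (force simp: supp_def)
  then show ?thesis using b by (blast intro: supp_empty_imp_zero P.nat_pow_closed)
qed

text \<open>
  After division by the constant term, \<open>w\<close> is 1 minus a series without constant term, which is
  nilpotent.
\<close>

lemma invertible_if_constant_term_nonzero:
  assumes w: "w \<in> carrier P" "w 0 \<noteq> \<zero>"
  shows "\<exists>v\<in>carrier P. w \<otimes>\<^bsub>P\<^esub> v = \<one>\<^bsub>P\<^esub>"
proof -
  define k where "k = monomial (inv (w 0)) 0"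
  have u: "w 0 \<in> Units K" using w by (simp add: field_Units)
  then have k: "k \<in> carrier P" unfolding k_def by (intro monomial_closed Units_inv_closed)
  define b where "b = \<one>\<^bsub>P\<^esub> \<ominus>\<^bsub>P\<^esub> k \<otimes>\<^bsub>P\<^esub> w"
  have b: "b \<in> carrier P" unfolding b_def using k w by simp
  have "b \<oplus>\<^bsub>P\<^esub> k \<otimes>\<^bsub>P\<^esub> w = \<one>\<^bsub>P\<^esub>"
    unfolding b_def using k w by (simp add: P.minus_eq P.a_assoc P.l_neg)
  then have "(b \<oplus>\<^bsub>P\<^esub> k \<otimes>\<^bsub>P\<^esub> w) 0 = \<one>" by (simp add: one_P const_series_def)
  moreover have "(k \<otimes>\<^bsub>P\<^esub> w) 0 = \<one>"
    using k w u by (simp add: mult_at_zero) (simp add: k_def monomial_apply)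
  ultimately have "b 0 \<oplus> \<one> = \<one>" by (simp add: add_P)
  moreover have "b 0 \<in> carrier K" using b by auto
  ultimately have "b 0 = \<zero>" by (simp add: add.r_cancel_one)
  then obtain n :: nat where "b [^]\<^bsub>P\<^esub> n = \<zero>\<^bsub>P\<^esub>" using nilpotent_if_constant_term_zero b by blast
  then obtain s where s: "s \<in> carrier P" "(\<one>\<^bsub>P\<^esub> \<ominus>\<^bsub>P\<^esub> b) \<otimes>\<^bsub>P\<^esub> s = \<one>\<^bsub>P\<^esub>"
    using P.one_minus_nilpotent_invertible[OF b] by blast
  have "\<one>\<^bsub>P\<^esub> \<ominus>\<^bsub>P\<^esub> b = k \<otimes>\<^bsub>P\<^esub> w"
    unfolding b_def using k w by (simp add: P.minus_eq P.minus_add P.r_neg2)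
  then have "w \<otimes>\<^bsub>P\<^esub> (k \<otimes>\<^bsub>P\<^esub> s) = \<one>\<^bsub>P\<^esub>"
    using s k w by (simp add: P.m_ac)
  then show ?thesis using k s by blast
qed

text \<open>
  Dividing \<open>x\<close> by \<open>t\<^sup>u\<close> leaves a series with constant term \<open>x(u) \<noteq> 0\<close>, a unit.
\<close>

lemma associated_to_monomial:
  assumes "x \<in> carrier P" "u \<in> supp K x" "supp K x \<subseteq> {u..}"
  obtains v w where "v \<in> carrier P" "w \<in> carrier P" "t u = v \<otimes>\<^bsub>P\<^esub> x" "x = w \<otimes>\<^bsub>P\<^esub> t u"
proof -
  have u: "u \<in> {0..1}" "x u \<noteq> \<zero>" using assms(2) by (auto simp: supp_def)
  obtain w where w: "w \<in> carrier P" "x = t u \<otimes>\<^bsub>P\<^esub> w" "w 0 = x u"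
    using t_dvd_if_exponents_ge[OF assms(1) u(1) assms(3)] .
  then obtain v where v: "v \<in> carrier P" "w \<otimes>\<^bsub>P\<^esub> v = \<one>\<^bsub>P\<^esub>"
    using invertible_if_constant_term_nonzero u by metis
  have "v \<otimes>\<^bsub>P\<^esub> x = t u \<otimes>\<^bsub>P\<^esub> (w \<otimes>\<^bsub>P\<^esub> v)" using v(1) w(1) by (simp add: w(2) P.m_ac)
  then have "t u = v \<otimes>\<^bsub>P\<^esub> x" using v(2) by simp
  moreover have "x = w \<otimes>\<^bsub>P\<^esub> t u" using w P.m_comm by simp
  ultimately show thesis using that v w by blast
qed

lemma dvd_if_exponents_ge:
  assumes x: "x \<in> carrier P" "u \<in> supp K x" "supp K x \<subseteq> {u..}"
    and y: "y \<in> carrier P" "supp K y \<subseteq> {u..}"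
  shows "\<exists>c\<in>carrier P. y = c \<otimes>\<^bsub>P\<^esub> x"
proof -
  have u: "u \<in> {0..1}" using x(2) by (auto simp: supp_def)
  obtain b where b: "b \<in> carrier P" "y = t u \<otimes>\<^bsub>P\<^esub> b" using t_dvd_if_exponents_ge[OF y(1) u y(2)] .
  obtain v where v: "v \<in> carrier P" "t u = v \<otimes>\<^bsub>P\<^esub> x" using associated_to_monomial[OF x] .
  have "y = (b \<otimes>\<^bsub>P\<^esub> v) \<otimes>\<^bsub>P\<^esub> x" using b v x by (simp add: P.m_ac)
  then show ?thesis using b v by blast
qed

section \<open>The reduced quotient\<close>

text \<open>
  Taking the constant term is multiplicative, so no power of a series with nonzero constant term
  vanishes.
\<close>

lemma nilradical_P: "nilradical P = {a \<in> carrier P. a 0 = \<zero>}"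
proof -
  have pow: "(a [^]\<^bsub>P\<^esub> n) 0 \<noteq> \<zero>" if "a \<in> carrier P" "a 0 \<noteq> \<zero>" for a and n :: nat
  proof (induction n)
    case 0
    then show ?case by (simp add: one_P const_series_def)
  next
    case (Suc n)
    then show ?case using that by (simp add: mult_at_zero integral_iff)
  qed
  have "a 0 = \<zero>" if "a \<in> carrier P" "a [^]\<^bsub>P\<^esub> n = \<zero>\<^bsub>P\<^esub>" for a and n :: nat
    using pow[OF that(1), of n] that(2) zero_P[of 0] by auto
  then show ?thesis unfolding nilradical_def using nilpotent_if_constant_term_zero by blast
qed

lemma ideal_nilradical_P: "ideal (nilradical P) P"
  by (rule cring_idealI[OF cring_P]) (auto simp: nilradical_P zero_P add_P mult_at_zero)

lemma const_series_ring_hom: "const_series K \<in> ring_hom K P"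
proof (rule ring_hom_memI)
  fix x y assume xy: "x \<in> carrier K" "y \<in> carrier K"
  show "const_series K (x \<otimes> y) = const_series K x \<otimes>\<^bsub>P\<^esub> const_series K y"
    unfolding mult_P const_series_eq_monomial using xy
    by (intro P_eqI conv_closed) (auto simp: conv_monomial monomial_apply)
  show "const_series K (x \<oplus> y) = const_series K x \<oplus>\<^bsub>P\<^esub> const_series K y"
    unfolding const_series_eq_monomial using xy
    by (intro P_eqI add_P_closed) (auto simp: add_P monomial_apply)
qed (auto simp: one_P const_series_eq_monomial)

text \<open>
  Two series are congruent modulo the nilradical exactly when their constant terms agree, so each
  coset contains exactly one constant series.
\<close>

lemma reduced_quotient_iso:
  "(\<lambda>c. nilradical P +>\<^bsub>P\<^esub> const_series K c) \<in> ring_iso K (P Quot nilradical P)"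
proof -
  interpret N: ideal "nilradical P" P by (rule ideal_nilradical_P)
  have c: "const_series K k \<in> carrier P" "const_series K k 0 = k" if "k \<in> carrier K" for k
    using that by (simp_all add: const_series_eq_monomial monomial_apply)
  have eq: "nilradical P +>\<^bsub>P\<^esub> a = nilradical P +>\<^bsub>P\<^esub> b \<longleftrightarrow> a 0 = b 0"
    if ab: "a \<in> carrier P" "b \<in> carrier P" for a b
  proof -
    have "(a \<ominus>\<^bsub>P\<^esub> b) \<oplus>\<^bsub>P\<^esub> b = a"
      using ab by (simp add: P.minus_eq P.a_assoc P.l_neg)
    then have *: "(a \<ominus>\<^bsub>P\<^esub> b) 0 \<oplus> b 0 = a 0" by (metis add_P atLeastAtMost_iff order_refl zero_le_one)
    have cl: "(a \<ominus>\<^bsub>P\<^esub> b) 0 \<in> carrier K" "b 0 \<in> carrier K" using ab by auto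
    have "(a \<ominus>\<^bsub>P\<^esub> b) 0 = \<zero> \<longleftrightarrow> a 0 = b 0"
    proof
      assume "(a \<ominus>\<^bsub>P\<^esub> b) 0 = \<zero>"
      with * have "\<zero> \<oplus> b 0 = a 0" by simp
      then show "a 0 = b 0" using cl(2) by simp
    next
      assume "a 0 = b 0"
      with * have "(a \<ominus>\<^bsub>P\<^esub> b) 0 \<oplus> b 0 = b 0" by simp
      then show "(a \<ominus>\<^bsub>P\<^esub> b) 0 = \<zero>" using add.r_cancel_one[OF cl(2,1)] by blast
    qed
    then have "a \<ominus>\<^bsub>P\<^esub> b \<in> nilradical P \<longleftrightarrow> a 0 = b 0"
      unfolding nilradical_P mem_Collect_eq using P.minus_closed[OF ab] by blast
    then show ?thesis
      using P.quotient_eq_iff_same_a_r_cos[OF ideal_nilradical_P ab] by simp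
  qed
  have "(\<lambda>c. nilradical P +>\<^bsub>P\<^esub> const_series K c) \<in> ring_hom K (P Quot nilradical P)"
    using ring_hom_trans[OF const_series_ring_hom N.rcos_ring_hom] by (simp add: comp_def)
  moreover have "bij_betw (\<lambda>c. nilradical P +>\<^bsub>P\<^esub> const_series K c) (carrier K)
      (carrier (P Quot nilradical P))"
  proof (rule bij_betw_imageI)
    show "inj_on (\<lambda>c. nilradical P +>\<^bsub>P\<^esub> const_series K c) (carrier K)"
      by (rule inj_onI) (use eq c in metis)
    show "(\<lambda>c. nilradical P +>\<^bsub>P\<^esub> const_series K c) ` carrier K = carrier (P Quot nilradical P)"
    proof -
      have "nilradical P +>\<^bsub>P\<^esub> a = nilradical P +>\<^bsub>P\<^esub> const_series K (a 0)" if "a \<in> carrier P" for a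
        using eq[OF that c(1)] c(2) value_closed[OF that, of 0] by simp
      moreover have "a 0 \<in> carrier K" if "a \<in> carrier P" for a using value_closed[OF that, of 0] by simp
      ultimately show ?thesis
        using c(1) by (fastforce simp: FactRing_def A_RCOSETS_def')
    qed
  qed
  ultimately show ?thesis by (simp add: ring_iso_def)
qed

end

section \<open>Self-injectivity\<close>

context root_series_field
begin

text \<open>
  The coefficient of \<open>f(x)\<close> at \<open>u\<close> is the coefficient of \<open>f(t\<^sup>1\<^sup>-\<^sup>u x)\<close> at 1, so \<open>f\<close> is determined by the
  coefficients at 1 of its values. Reading them off at the monomials of \<open>I\<close> gives \<open>z\<close>. The equation
  then holds on monomials, and extends to \<open>I\<close> because every element of \<open>I\<close> is a multiple of a monomial
  in \<open>I\<close>.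
\<close>

lemma ideal_hom_is_multiplication:
  assumes I: "ideal I P" and f: "f \<in> lin_hom P (ideal_module P I) (ideal_module P (carrier P))"
  shows "\<exists>z\<in>carrier P. \<forall>x\<in>I. f x = x \<otimes>\<^bsub>P\<^esub> z"
proof -
  interpret I: ideal I P by (rule I)
  have fc: "f x \<in> carrier P" if "x \<in> I" for x
    using lin_homD(1)[OF f] that by (simp add: ideal_module_def)
  have fm: "f (r \<otimes>\<^bsub>P\<^esub> x) = r \<otimes>\<^bsub>P\<^esub> f x" if "r \<in> carrier P" "x \<in> I" for r x
    using lin_homD(3)[OF f] that by (simp add: ideal_module_def)
  have f0: "f \<zero>\<^bsub>P\<^esub> = \<zero>\<^bsub>P\<^esub>"
    using fm[of "\<zero>\<^bsub>P\<^esub>" "\<zero>\<^bsub>P\<^esub>"] fc[of "\<zero>\<^bsub>P\<^esub>"] by simp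
  have at_one: "f (t r) u = f (t (1 - u) \<otimes>\<^bsub>P\<^esub> t r) 1" if "t r \<in> I" "u \<in> {0..1}" for r u
    using fm[of "t (1 - u)" "t r"] fc[OF that(1)] that by (simp add: t_mult_apply)
  define z where "z = (\<lambda>s\<in>{0..1}. if t (1 - s) \<in> I then f (t (1 - s)) 1 else \<zero>)"
  have shift: "f (t r) u = z (u - r)" if "t r \<in> I" "r \<in> {0..1}" "u \<in> {r..1}" for r u
  proof -
    have eq: "t (1 - u) \<otimes>\<^bsub>P\<^esub> t r = t (1 - (u - r))"
      using t_mult[of "1 - u" r] that by (simp add: algebra_simps)
    then have "t (1 - (u - r)) \<in> I" using I.I_l_closed[OF that(1), of "t (1 - u)"] by simp
    then show ?thesis using at_one[OF that(1), of u] that eq by (simp add: z_def)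
  qed
  have z: "z \<in> carrier P"
    unfolding z_def
  proof (rule restrict_mem_P)
    show "(if t (1 - s) \<in> I then f (t (1 - s)) 1 else \<zero>) \<in> carrier K" for s
      using value_closed[OF fc] by simp
    let ?Z = "{s \<in> {0..1}. (if t (1 - s) \<in> I then f (t (1 - s)) 1 else \<zero>) \<noteq> \<zero>}"
    show "well_ordered ?Z"
      unfolding well_ordered_def
    proof (intro allI impI, elim conjE)
      fix S assume S: "S \<subseteq> ?Z" "S \<noteq> {}"
      then obtain s0 where s0: "s0 \<in> S" by blast
      \<comment> \<open>up to \<open>s0\<close>, the coefficients of \<open>z\<close> are those of \<open>f (t r)\<close>, shifted by \<open>r\<close>\<close>
      define r where "r = 1 - s0"
      have r: "t r \<in> I" "r \<in> {0..1}" using s0 S by (auto simp: r_def split: if_splits)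
      have "(\<lambda>s. s + r) ` {s\<in>S. s \<le> s0} \<subseteq> supp K (f (t r))"
      proof (rule image_subsetI)
        fix s assume "s \<in> {s\<in>S. s \<le> s0}"
        then have s: "s \<in> ?Z" and "s \<le> s0" using S(1) by blast+
        then have sr: "s + r \<in> {r..1}" by (simp add: r_def)
        from s have "z s \<noteq> \<zero>" by (simp add: z_def)
        then show "s + r \<in> supp K (f (t r))"
          using shift[OF r sr] sr r(2) by (simp add: supp_def)
      qed
      then have "\<exists>m\<in>(\<lambda>s. s + r) ` {s\<in>S. s \<le> s0}. \<forall>x\<in>(\<lambda>s. s + r) ` {s\<in>S. s \<le> s0}. m \<le> x"
        using s0 by (intro well_orderedD[OF well_ordered_supp[OF fc[OF r(1)]], of _ "s0 + r"]) auto
      then obtain m where m: "m \<in> S" "m \<le> s0" "\<And>s. s \<in> S \<Longrightarrow> s \<le> s0 \<Longrightarrow> m \<le> s" by auto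
      then have "m \<le> s" if "s \<in> S" for s using that by (cases "s \<le> s0") auto
      then show "\<exists>m\<in>S. \<forall>s\<in>S. m \<le> s" using m(1) by blast
    qed
  qed
  have on_monomials: "f (t r) = t r \<otimes>\<^bsub>P\<^esub> z" if r: "t r \<in> I" "r \<in> {0..1}" for r
  proof (rule P_eqI)
    fix q :: real assume q: "q \<in> {0..1}"
    show "f (t r) q = (t r \<otimes>\<^bsub>P\<^esub> z) q"
    proof (cases "r \<le> q")
      case True
      then show ?thesis using shift[OF r, of q] q r z by (simp add: t_mult_apply)
    next
      case False
      have "t (1 - q) \<otimes>\<^bsub>P\<^esub> t r = \<zero>\<^bsub>P\<^esub>"
        using False supp_monomial
        by (intro mult_zero_if_exponents_exceed[of _ _ "1 - q" r]) (auto dest!: subsetD[OF supp_monomial])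
      then have "f (t r) q = \<zero>" using at_one[OF r(1) q] f0 by (simp add: zero_P)
      then show ?thesis using False q r z by (simp add: t_mult_apply coefficient_def)
    qed
  qed (use fc[OF r(1)] z in auto)
  have "f x = x \<otimes>\<^bsub>P\<^esub> z" if x: "x \<in> I" for x
  proof (cases "x = \<zero>\<^bsub>P\<^esub>")
    case True
    then show ?thesis using f0 z by simp
  next
    case False
    have xc: "x \<in> carrier P" using x by (rule I.a_Hcarr)
    obtain u where u: "u \<in> supp K x" "supp K x \<subseteq> {u..}" using least_exponent[OF xc False] .
    obtain v w where vw: "v \<in> carrier P" "w \<in> carrier P" "t u = v \<otimes>\<^bsub>P\<^esub> x" "x = w \<otimes>\<^bsub>P\<^esub> t u"
      using associated_to_monomial[OF xc u] .
    have tu: "t u \<in> I" unfolding vw(3) by (rule I.I_l_closed[OF x vw(1)])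
    have "u \<in> {0..1}" using u(1) by (simp add: supp_def)
    then have "f (t u) = t u \<otimes>\<^bsub>P\<^esub> z" using on_monomials tu by blast
    then have "f (w \<otimes>\<^bsub>P\<^esub> t u) = (w \<otimes>\<^bsub>P\<^esub> t u) \<otimes>\<^bsub>P\<^esub> z"
      using fm[OF vw(2) tu] vw(2) z by (simp add: P.m_assoc)
    then show ?thesis using vw(4) by simp
  qed
  then show ?thesis using z by blast
qed

lemma self_injective_P: "self_injective TYPE('m) TYPE('n) P"
  unfolding self_injective_def
proof (rule baer_criterion)
  show "Module.module P (ideal_module P (carrier P))"
    by (rule ideal_module_is_module[OF cring_P P.oneideal])
  show "\<exists>z\<in>carrier (ideal_module P (carrier P)). \<forall>r\<in>I. h r = r \<odot>\<^bsub>ideal_module P (carrier P)\<^esub> z"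
    if "ideal I P" "h \<in> lin_hom P (ideal_module P I) (ideal_module P (carrier P))" for I h
    using ideal_hom_is_multiplication[OF that] by (simp add: ideal_module_def)
qed

end

section \<open>Finitely presented ideals\<close>

definition unit_vector :: "('r, 'c) ring_scheme \<Rightarrow> nat \<Rightarrow> nat \<Rightarrow> nat \<Rightarrow> 'r"
  where "unit_vector R n i = (\<lambda>j\<in>{..<n}. if j = i then \<one>\<^bsub>R\<^esub> else \<zero>\<^bsub>R\<^esub>)"

context cring
begin

lemma unit_vector_closed: "unit_vector R n i \<in> carrier (free_module R n)"
  by (auto simp: unit_vector_def free_module_def)

lemma free_module_smult_closed:
  "r \<in> carrier R \<Longrightarrow> y \<in> carrier (free_module R n) \<Longrightarrow> r \<odot>\<^bsub>free_module R n\<^esub> y \<in> carrier (free_module R n)"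
  by (auto simp: free_module_def PiE_iff)

lemma free_module_zero_closed: "\<zero>\<^bsub>free_module R n\<^esub> \<in> carrier (free_module R n)"
  by (auto simp: free_module_def)

lemma free_module_apply_outside:
  "x \<in> carrier (free_module R n) \<Longrightarrow> \<not> j < n \<Longrightarrow> x j = undefined"
  by (simp add: free_module_def PiE_def extensional_def)

text \<open>
  A vector is built up by adding one coordinate at a time. This replaces explicit linear
  combinations when a property of linear maps has to be checked on unit vectors only.
\<close>

lemma free_module_induct:
  assumes x: "x \<in> carrier (free_module R n)"
    and zero: "Q \<zero>\<^bsub>free_module R n\<^esub>"
    and step: "\<And>i r y. i < n \<Longrightarrow> r \<in> carrier R \<Longrightarrow> y \<in> carrier (free_module R n) \<Longrightarrow> Q y \<Longrightarrow>
      Q (y \<oplus>\<^bsub>free_module R n\<^esub> r \<odot>\<^bsub>free_module R n\<^esub> unit_vector R n i)"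
  shows "Q x"
proof -
  have x_closed: "x i \<in> carrier R" if "i < n" for i
    using x that by (auto simp: free_module_def)
  define y where "y k = (\<lambda>j\<in>{..<n}. if j < k then x j else \<zero>)" for k
  have y: "y k \<in> carrier (free_module R n)" for k
    using x_closed by (auto simp: y_def free_module_def)
  have "k \<le> n \<Longrightarrow> Q (y k)" for k
  proof (induction k)
    case 0
    have "y 0 = \<zero>\<^bsub>free_module R n\<^esub>" by (auto simp: y_def free_module_def)
    then show ?case using zero by simp
  next
    case (Suc k)
    have "y (Suc k) = y k \<oplus>\<^bsub>free_module R n\<^esub> x k \<odot>\<^bsub>free_module R n\<^esub> unit_vector R n k"
    proof
      fix j
      show "y (Suc k) j = (y k \<oplus>\<^bsub>free_module R n\<^esub> x k \<odot>\<^bsub>free_module R n\<^esub> unit_vector R n k) j"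
        using x_closed[of j] x_closed[of k] Suc.prems
        by (cases "j < k"; cases "j = k"; cases "j < n") (auto simp: y_def free_module_def unit_vector_def)
    qed
    moreover have "Q (y k)" using Suc by simp
    ultimately show ?case using step[of k "x k" "y k"] Suc.prems x_closed[of k] y by simp
  qed
  moreover have "y n = x"
  proof
    fix j show "y n j = x j"
      using free_module_apply_outside[OF x] by (cases "j < n") (auto simp: y_def)
  qed
  ultimately show ?thesis using order_refl[of n] by blast
qed

lemma lin_hom_free_module_zero:
  assumes h: "h \<in> lin_hom R (free_module R n) (ideal_module R J)" and J: "J \<subseteq> carrier R"
  shows "h \<zero>\<^bsub>free_module R n\<^esub> = \<zero>"
proof -
  have "\<zero> \<odot>\<^bsub>free_module R n\<^esub> \<zero>\<^bsub>free_module R n\<^esub> = \<zero>\<^bsub>free_module R n\<^esub>"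
    by (auto simp: free_module_def)
  moreover have "h (\<zero> \<odot>\<^bsub>free_module R n\<^esub> \<zero>\<^bsub>free_module R n\<^esub>) = \<zero> \<otimes> h \<zero>\<^bsub>free_module R n\<^esub>"
    using lin_homD(3)[OF h zero_closed free_module_zero_closed] by (simp add: ideal_module_def)
  moreover have "h \<zero>\<^bsub>free_module R n\<^esub> \<in> carrier R"
    using lin_homD(1)[OF h free_module_zero_closed] J by (auto simp: ideal_module_def)
  ultimately show ?thesis by simp
qed

lemma lin_hom_add_multiple:
  assumes h: "h \<in> lin_hom R (free_module R n) (ideal_module R J)"
    and "r \<in> carrier R" "y \<in> carrier (free_module R n)"
  shows "h (y \<oplus>\<^bsub>free_module R n\<^esub> r \<odot>\<^bsub>free_module R n\<^esub> unit_vector R n i)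
    = h y \<oplus> r \<otimes> h (unit_vector R n i)"
  using lin_homD(2)[OF h assms(3) free_module_smult_closed[OF assms(2) unit_vector_closed]]
    lin_homD(3)[OF h assms(2) unit_vector_closed]
  by (simp add: ideal_module_def)

lemma lin_hom_image_in_ideal:
  assumes h: "h \<in> lin_hom R (free_module R n) (ideal_module R J)" and J: "J \<subseteq> carrier R"
    and L: "ideal L R" and basis: "\<And>i. i < n \<Longrightarrow> h (unit_vector R n i) \<in> L"
    and x: "x \<in> carrier (free_module R n)"
  shows "h x \<in> L"
proof -
  interpret L: ideal L R by (rule L)
  show ?thesis
  proof (rule free_module_induct[OF x])
    show "h \<zero>\<^bsub>free_module R n\<^esub> \<in> L" using lin_hom_free_module_zero[OF h J] by simp
    show "h (y \<oplus>\<^bsub>free_module R n\<^esub> r \<odot>\<^bsub>free_module R n\<^esub> unit_vector R n i) \<in> L"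
      if "i < n" "r \<in> carrier R" "y \<in> carrier (free_module R n)" "h y \<in> L" for i r y
      unfolding lin_hom_add_multiple[OF h that(2,3)]
      by (intro L.a_closed that(4) L.I_l_closed basis that)
  qed
qed

text \<open>
  The universal property of the free module, with values in the ring.
\<close>

lemma lin_hom_with_values:
  assumes c: "\<And>i. i < n \<Longrightarrow> c i \<in> carrier R"
  obtains p where "p \<in> lin_hom R (free_module R n) (ideal_module R (carrier R))"
    "\<And>i. i < n \<Longrightarrow> p (unit_vector R n i) = c i"
proof -
  define p where "p y = (\<Oplus>i\<in>{..<n}. y i \<otimes> c i)" for y :: "nat \<Rightarrow> 'a"
  have v: "y i \<in> carrier R" if "y \<in> carrier (free_module R n)" "i < n" for y i
    using that by (auto simp: free_module_def)
  have "p \<in> lin_hom R (free_module R n) (ideal_module R (carrier R))"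
    unfolding lin_hom_def
  proof (intro CollectI conjI ballI)
    show "p \<in> carrier (free_module R n) \<rightarrow> carrier (ideal_module R (carrier R))"
      using v c by (auto simp: p_def ideal_module_def intro!: finsum_closed)
    fix x y assume x: "x \<in> carrier (free_module R n)" and y: "y \<in> carrier (free_module R n)"
    have "p (x \<oplus>\<^bsub>free_module R n\<^esub> y) = (\<Oplus>i\<in>{..<n}. x i \<otimes> c i \<oplus> y i \<otimes> c i)"
      unfolding p_def using v[OF x] v[OF y] c
      by (intro finsum_cong') (auto simp: free_module_def l_distr)
    also have "\<dots> = p x \<oplus> p y"
      unfolding p_def using v[OF x] v[OF y] c by (intro finsum_addf) auto
    finally show "p (x \<oplus>\<^bsub>free_module R n\<^esub> y) = p x \<oplus>\<^bsub>ideal_module R (carrier R)\<^esub> p y"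
      by (simp add: ideal_module_def)
  next
    fix r x assume r: "r \<in> carrier R" and x: "x \<in> carrier (free_module R n)"
    have "p (r \<odot>\<^bsub>free_module R n\<^esub> x) = (\<Oplus>i\<in>{..<n}. r \<otimes> (x i \<otimes> c i))"
      unfolding p_def using v[OF x] r c
      by (intro finsum_cong') (auto simp: free_module_def m_assoc)
    also have "\<dots> = r \<otimes> p x"
      unfolding p_def using v[OF x] r c by (intro finsum_rdistr[symmetric]) auto
    finally show "p (r \<odot>\<^bsub>free_module R n\<^esub> x) = r \<odot>\<^bsub>ideal_module R (carrier R)\<^esub> p x"
      by (simp add: ideal_module_def)
  qed
  moreover have "p (unit_vector R n i) = c i" if i: "i < n" for i
  proof -
    have "p (unit_vector R n i) = (\<Oplus>j\<in>{..<n}. if i = j then c j else \<zero>)"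
      unfolding p_def using c i by (intro finsum_cong') (auto simp: unit_vector_def)
    also have "\<dots> = c i" using c i by (intro finsum_singleton) auto
    finally show ?thesis .
  qed
  ultimately show thesis using that by blast
qed

lemma finitely_presented_zero_ideal: "finitely_presented R (ideal_module R {\<zero>})"
  unfolding finitely_presented_def
proof (intro conjI exI)
  show "Module.module R (ideal_module R {\<zero>})"
    by (rule ideal_module_is_module[OF is_cring zeroideal])
  have free: "carrier (free_module R 0) = {\<lambda>_. undefined}" by (simp add: free_module_def)
  show "\<exists>f\<in>lin_hom R (free_module R 0) (free_module R 0).
    \<exists>g\<in>lin_hom R (free_module R 0) (ideal_module R {\<zero>}).
      g ` carrier (free_module R 0) = carrier (ideal_module R {\<zero>}) \<and>
      f ` carrier (free_module R 0) = {x \<in> carrier (free_module R 0). g x = \<zero>\<^bsub>ideal_module R {\<zero>}\<^esub>}"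
  proof (intro bexI conjI)
    show "(\<lambda>x. x) \<in> lin_hom R (free_module R 0) (free_module R 0)" by (auto simp: lin_hom_def)
    show "(\<lambda>_. \<zero>) \<in> lin_hom R (free_module R 0) (ideal_module R {\<zero>})"
      by (auto simp: lin_hom_def ideal_module_def)
  qed (auto simp: free ideal_module_def)
qed

lemma finitely_presented_unit_ideal: "finitely_presented R (ideal_module R (carrier R))"
  unfolding finitely_presented_def
proof (intro conjI exI)
  show "Module.module R (ideal_module R (carrier R))"
    by (rule ideal_module_is_module[OF is_cring oneideal])
  let ?g = "\<lambda>x :: nat \<Rightarrow> 'a. x 0" and ?f = "\<lambda>_ :: nat \<Rightarrow> 'a. \<zero>\<^bsub>free_module R (Suc 0)\<^esub>"
  have free: "carrier (free_module R 0) = {\<lambda>_. undefined}" by (simp add: free_module_def)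
  show "\<exists>f\<in>lin_hom R (free_module R 0) (free_module R (Suc 0)).
    \<exists>g\<in>lin_hom R (free_module R (Suc 0)) (ideal_module R (carrier R)).
      g ` carrier (free_module R (Suc 0)) = carrier (ideal_module R (carrier R)) \<and>
      f ` carrier (free_module R 0)
        = {x \<in> carrier (free_module R (Suc 0)). g x = \<zero>\<^bsub>ideal_module R (carrier R)\<^esub>}"
  proof (intro bexI conjI)
    show "?f \<in> lin_hom R (free_module R 0) (free_module R (Suc 0))"
      by (auto simp: lin_hom_def free_module_def)
    show "?g \<in> lin_hom R (free_module R (Suc 0)) (ideal_module R (carrier R))"
      by (auto simp: lin_hom_def free_module_def ideal_module_def)
    show "?g ` carrier (free_module R (Suc 0)) = carrier (ideal_module R (carrier R))"
    proof
      show "?g ` carrier (free_module R (Suc 0)) \<subseteq> carrier (ideal_module R (carrier R))"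
        by (auto simp: free_module_def ideal_module_def)
      show "carrier (ideal_module R (carrier R)) \<subseteq> ?g ` carrier (free_module R (Suc 0))"
      proof
        fix r assume "r \<in> carrier (ideal_module R (carrier R))"
        then show "r \<in> ?g ` carrier (free_module R (Suc 0))"
          by (intro image_eqI[of _ _ "\<lambda>i\<in>{..<Suc 0}. r"]) (auto simp: free_module_def ideal_module_def)
      qed
    qed
    have "x = \<zero>\<^bsub>free_module R (Suc 0)\<^esub>"
      if x: "x \<in> carrier (free_module R (Suc 0))" "x 0 = \<zero>" for x
    proof
      fix j show "x j = \<zero>\<^bsub>free_module R (Suc 0)\<^esub> j"
        using x(2) free_module_apply_outside[OF x(1), of j] by (cases j) (auto simp: free_module_def)
    qed
    moreover have "\<zero>\<^bsub>free_module R (Suc 0)\<^esub> 0 = \<zero>" by (simp add: free_module_def)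
    ultimately show "?f ` carrier (free_module R 0)
        = {x \<in> carrier (free_module R (Suc 0)). x 0 = \<zero>\<^bsub>ideal_module R (carrier R)\<^esub>}"
      using free_module_zero_closed by (auto simp: free ideal_module_def)
  qed
qed

end

section \<open>Total incoherence\<close>

context root_series_field
begin

lemma ideal_exponents_ge: "ideal {a \<in> carrier P. supp K a \<subseteq> {u..}} P"
proof (rule cring_idealI[OF cring_P])
  let ?L = "{a \<in> carrier P. supp K a \<subseteq> {u..}}"
  show "\<zero>\<^bsub>P\<^esub> \<in> ?L" by (simp add: supp_zero)
  show "x \<oplus>\<^bsub>P\<^esub> y \<in> ?L" if "x \<in> ?L" "y \<in> ?L" for x y
  proof -
    have "supp K (x \<oplus>\<^bsub>P\<^esub> y) \<subseteq> supp K x \<union> supp K y" by (auto simp: supp_def add_P)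
    then show ?thesis using that by auto
  qed
  show "r \<otimes>\<^bsub>P\<^esub> x \<in> ?L" if "r \<in> carrier P" "x \<in> ?L" for r x
  proof -
    have "supp K r \<subseteq> {0..}" by (auto simp: supp_def)
    then show ?thesis using supp_mult_lower[of r x 0 u] that by auto
  qed
qed auto

text \<open>
  If the least exponent \<open>v\<close> of \<open>r\<close> were at most \<open>1 - u\<close>, the lowest terms of \<open>r\<close> and \<open>x\<close> would multiply
  to a nonzero term at \<open>v + u \<le> 1\<close>.
\<close>

lemma annihilator_exponents:
  assumes x: "x \<in> carrier P" "u \<in> supp K x" "supp K x \<subseteq> {u..}"
    and r: "r \<in> carrier P" "r \<otimes>\<^bsub>P\<^esub> x = \<zero>\<^bsub>P\<^esub>" and "u > 0"
  shows "\<exists>v>1 - u. v \<le> 1 \<and> supp K r \<subseteq> {v..}"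
proof (cases "r = \<zero>\<^bsub>P\<^esub>")
  case True
  then show ?thesis using \<open>u > 0\<close> by (intro exI[of _ 1]) (simp add: supp_zero)
next
  case False
  then obtain v where v: "v \<in> supp K r" "supp K r \<subseteq> {v..}" using least_exponent r(1) by blast
  have "v > 1 - u"
  proof (rule ccontr)
    assume "\<not> v > 1 - u"
    then have uv: "0 \<le> v" "0 \<le> u" "v + u \<le> 1" using v(1) x(2) by (auto simp: supp_def)
    then have "(r \<otimes>\<^bsub>P\<^esub> x) (v + u) = r v \<otimes> x u" by (intro mult_lowest r x v)
    then have "r v \<otimes> x u = \<zero>" using uv by (simp add: r(2) zero_P)
    moreover have "r v \<in> carrier K" "x u \<in> carrier K" "r v \<noteq> \<zero>" "x u \<noteq> \<zero>"
      using v(1) x(2) r(1) x(1) by (auto simp: supp_def)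
    ultimately show False by (simp add: integral_iff)
  qed
  then show ?thesis using v by (intro exI[of _ v]) (auto simp: supp_def)
qed

text \<open>
  Let \<open>x\<^sub>j\<close> be the generator of least exponent and write the other generators as \<open>x\<^sub>i = c\<^sub>i x\<^sub>j\<close>. The
  linear form \<open>p\<close> with coefficients \<open>c\<^sub>i\<close> satisfies \<open>g(y) = p(y) x\<^sub>j\<close>, so it maps the kernel of \<open>g\<close> onto the
  annihilator of \<open>x\<^sub>j\<close>; this transports finite generation from relations in \<open>n\<close> generators to the
  annihilator of a single element.
\<close>

lemma finitely_presented_ideal_trivial:
  assumes I: "ideal I P" and fp: "finitely_presented P (ideal_module P I)"
  shows "I = {\<zero>\<^bsub>P\<^esub>} \<or> I = carrier P"
proof -
  interpret I: ideal I P by (rule I)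
  obtain m n f g where f: "f \<in> lin_hom P (free_module P m) (free_module P n)"
    and g: "g \<in> lin_hom P (free_module P n) (ideal_module P I)"
    and gI: "g ` carrier (free_module P n) = I"
    and ker: "f ` carrier (free_module P m) = {x \<in> carrier (free_module P n). g x = \<zero>\<^bsub>P\<^esub>}"
    using fp unfolding finitely_presented_def by (auto simp: ideal_module_def)
  define x where "x i = g (unit_vector P n i)" for i
  have xI: "x i \<in> I" for i
    unfolding x_def using gI P.unit_vector_closed by blast
  then have xc: "x i \<in> carrier P" for i using I.a_Hcarr by blast
  define J where "J = {i. i < n \<and> x i \<noteq> \<zero>\<^bsub>P\<^esub>}"
  show ?thesis
  proof (cases "J = {}")
    case True
    then have "g (unit_vector P n i) \<in> {\<zero>\<^bsub>P\<^esub>}" if "i < n" for i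
      using that unfolding J_def x_def by blast
    then have "g y \<in> {\<zero>\<^bsub>P\<^esub>}" if "y \<in> carrier (free_module P n)" for y
      using that by (rule P.lin_hom_image_in_ideal[OF g I.a_subset P.zeroideal])
    then have "I = {\<zero>\<^bsub>P\<^esub>}" using gI I.zero_closed by blast
    then show ?thesis ..
  next
    case False
    have "\<exists>u. u \<in> supp K (x i) \<and> supp K (x i) \<subseteq> {u..}" if "i \<in> J" for i
    proof -
      have "x i \<noteq> \<zero>\<^bsub>P\<^esub>" using that by (simp add: J_def)
      then show ?thesis by (rule least_exponent[OF xc]) blast
    qed
    then obtain e where e: "e i \<in> supp K (x i)" "supp K (x i) \<subseteq> {e i..}" if "i \<in> J" for i
      by metis
    have "finite (e ` J)" by (simp add: J_def)
    then have "Min (e ` J) \<in> e ` J" "\<And>i. i \<in> J \<Longrightarrow> Min (e ` J) \<le> e i"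
      using False by auto
    then obtain j where j: "j \<in> J" "\<And>i. i \<in> J \<Longrightarrow> e j \<le> e i" by auto
    define u where "u = e j"
    note xj = xc[of j] e[OF j(1), folded u_def]
    have u01: "u \<in> {0..1}" "x j u \<noteq> \<zero>" using xj(2) by (auto simp: supp_def)
    show ?thesis
    proof (cases "u = 0")
      case True
      then obtain v where v: "v \<in> carrier P" "x j \<otimes>\<^bsub>P\<^esub> v = \<one>\<^bsub>P\<^esub>"
        using invertible_if_constant_term_nonzero[OF xj(1)] u01 by auto
      then have "\<one>\<^bsub>P\<^esub> \<in> I" using I.I_r_closed[OF xI v(1), of j] by simp
      then show ?thesis using I.one_imp_carrier by blast
    next
      case False
      then have u: "u > 0" using u01 by simp
      have "\<exists>c\<in>carrier P. x i = c \<otimes>\<^bsub>P\<^esub> x j" if "i < n" for i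
      proof (rule dvd_if_exponents_ge[OF xj xc])
        show "supp K (x i) \<subseteq> {u..}"
        proof (cases "i \<in> J")
          case True
          then show ?thesis using e(2)[OF True] j(2)[OF True] by (auto simp: u_def)
        next
          case False
          then show ?thesis using that by (simp add: J_def supp_zero)
        qed
      qed
      then obtain c0 where c0: "c0 i \<in> carrier P" "x i = c0 i \<otimes>\<^bsub>P\<^esub> x j" if "i < n" for i
        by metis
      \<comment> \<open>With \<open>c\<^sub>j = 1\<close>, the form \<open>p\<close> sends \<open>r e\<^sub>j\<close> to \<open>r\<close>; an arbitrary choice of quotients would give
        this only up to the annihilator of \<open>x\<^sub>j\<close>.\<close>
      define c where "c i = (if i = j then \<one>\<^bsub>P\<^esub> else c0 i)" for i
      have c: "c i \<in> carrier P" "x i = c i \<otimes>\<^bsub>P\<^esub> x j" if "i < n" for i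
        using c0[OF that] xc by (auto simp: c_def)
      obtain p where p: "p \<in> lin_hom P (free_module P n) (ideal_module P (carrier P))"
        and p_basis: "\<And>i. i < n \<Longrightarrow> p (unit_vector P n i) = c i"
        using P.lin_hom_with_values[of n c] c by blast
      have pc: "p y \<in> carrier P" if "y \<in> carrier (free_module P n)" for y
        using lin_homD(1)[OF p that] by (simp add: ideal_module_def)
      have gp: "g y = p y \<otimes>\<^bsub>P\<^esub> x j" if "y \<in> carrier (free_module P n)" for y
      proof (rule P.free_module_induct[OF that])
        show "g \<zero>\<^bsub>free_module P n\<^esub> = p \<zero>\<^bsub>free_module P n\<^esub> \<otimes>\<^bsub>P\<^esub> x j"
          using P.lin_hom_free_module_zero[OF g I.a_subset] P.lin_hom_free_module_zero[OF p subset_refl] xc by simp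
      next
        fix i r y assume *: "i < n" "r \<in> carrier P" "y \<in> carrier (free_module P n)"
          and IH: "g y = p y \<otimes>\<^bsub>P\<^esub> x j"
        have "g (y \<oplus>\<^bsub>free_module P n\<^esub> r \<odot>\<^bsub>free_module P n\<^esub> unit_vector P n i)
            = p y \<otimes>\<^bsub>P\<^esub> x j \<oplus>\<^bsub>P\<^esub> r \<otimes>\<^bsub>P\<^esub> (c i \<otimes>\<^bsub>P\<^esub> x j)"
          using P.lin_hom_add_multiple[OF g *(2,3), of i] IH c(2)[OF *(1)] by (simp add: x_def)
        also have "\<dots> = (p y \<oplus>\<^bsub>P\<^esub> r \<otimes>\<^bsub>P\<^esub> c i) \<otimes>\<^bsub>P\<^esub> x j"
          using pc[OF *(3)] c(1)[OF *(1)] *(2) xc[of j] by (simp add: P.l_distr P.m_assoc)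
        also have "p y \<oplus>\<^bsub>P\<^esub> r \<otimes>\<^bsub>P\<^esub> c i
            = p (y \<oplus>\<^bsub>free_module P n\<^esub> r \<odot>\<^bsub>free_module P n\<^esub> unit_vector P n i)"
          using P.lin_hom_add_multiple[OF p *(2,3), of i] p_basis[OF *(1)] by simp
        finally show "g (y \<oplus>\<^bsub>free_module P n\<^esub> r \<odot>\<^bsub>free_module P n\<^esub> unit_vector P n i)
            = p (y \<oplus>\<^bsub>free_module P n\<^esub> r \<odot>\<^bsub>free_module P n\<^esub> unit_vector P n i) \<otimes>\<^bsub>P\<^esub> x j" .
      qed
      have fc: "f y \<in> carrier (free_module P n)" if "y \<in> carrier (free_module P m)" for y
        using lin_homD(1)[OF f that] .
      have "\<exists>v>1 - u. v \<le> 1 \<and> supp K (p (f (unit_vector P m l))) \<subseteq> {v..}" for l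
      proof (rule annihilator_exponents[OF xj _ _ u])
        have "f (unit_vector P m l) \<in> {x \<in> carrier (free_module P n). g x = \<zero>\<^bsub>P\<^esub>}"
          using ker P.unit_vector_closed by blast
        then show "p (f (unit_vector P m l)) \<in> carrier P"
          and "p (f (unit_vector P m l)) \<otimes>\<^bsub>P\<^esub> x j = \<zero>\<^bsub>P\<^esub>"
          using pc gp by auto
      qed
      then obtain d where d: "d l > 1 - u" "d l \<le> 1" "supp K (p (f (unit_vector P m l))) \<subseteq> {d l..}"
        for l by metis
      \<comment> \<open>inserting 1 covers the case \<open>m = 0\<close>\<close>
      define v where "v = Min (insert 1 (d ` {..<m}))"
      have v: "v \<le> 1" "v > 1 - u" "\<And>l. l < m \<Longrightarrow> v \<le> d l"
        unfolding v_def using d u by auto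
      let ?L = "{a \<in> carrier P. supp K a \<subseteq> {v..}}"
      have pf: "(\<lambda>y. p (f y)) \<in> lin_hom P (free_module P m) (ideal_module P (carrier P))"
        unfolding lin_hom_def
        using lin_homD[OF f] lin_homD[OF p] by auto
      have in_L: "p (f y) \<in> ?L" if "y \<in> carrier (free_module P m)" for y
      proof (rule P.lin_hom_image_in_ideal[OF pf subset_refl ideal_exponents_ge _ that])
        show "p (f (unit_vector P m l)) \<in> ?L" if "l < m" for l
          using d(3)[of l] v(3)[OF that] pc[OF fc[OF P.unit_vector_closed]] by auto
      qed
      \<comment> \<open>\<open>t\<^sup>s\<close> annihilates \<open>x\<^sub>j\<close>, but its exponent lies below those of \<open>p (f y)\<close> for all \<open>y\<close>\<close>
      define s where "s = (v + (1 - u)) / 2"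
      have s: "s < v" "s > 1 - u" "s \<in> {0..1}" using v u01 by (auto simp: s_def)
      have ann: "t s \<otimes>\<^bsub>P\<^esub> x j = \<zero>\<^bsub>P\<^esub>"
        using s supp_monomial[of \<one> s]
        by (intro mult_zero_if_exponents_exceed[OF _ xj(1) _ xj(3), of _ s]) auto
      have jn: "j < n" using j(1) by (simp add: J_def)
      let ?y = "t s \<odot>\<^bsub>free_module P n\<^esub> unit_vector P n j"
      have y: "?y \<in> carrier (free_module P n)"
        by (intro P.free_module_smult_closed P.unit_vector_closed monomial_closed) simp
      have py: "p ?y = t s"
        using lin_homD(3)[OF p _ P.unit_vector_closed, of "t s" j] p_basis[OF jn]
        by (simp add: ideal_module_def c_def)
      then have "g ?y = \<zero>\<^bsub>P\<^esub>" using gp[OF y] ann by simp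
      with y have "?y \<in> f ` carrier (free_module P m)" unfolding ker by (intro CollectI conjI)
      then obtain y' where "y' \<in> carrier (free_module P m)" "f y' = ?y" by (metis imageE)
      then have "t s \<in> ?L" using in_L[of y'] py by simp
      moreover have "s \<in> supp K (t s)" using s(3) by (simp add: supp_def monomial_apply)
      ultimately show ?thesis using s(1) by auto
    qed
  qed
qed

lemma totally_incoherent_P: "totally_incoherent P"
  unfolding totally_incoherent_def
proof
  show "{I. ideal I P \<and> finitely_presented P (ideal_module P I)} \<subseteq> {{\<zero>\<^bsub>P\<^esub>}, carrier P}"
    using finitely_presented_ideal_trivial by blast
  show "{{\<zero>\<^bsub>P\<^esub>}, carrier P} \<subseteq> {I. ideal I P \<and> finitely_presented P (ideal_module P I)}"
    using P.zeroideal P.oneideal P.finitely_presented_zero_ideal P.finitely_presented_unit_ideal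
    by blast
qed

end

theorem theorem1p13:
  fixes K :: "('k, 'c) ring_scheme"
  assumes "field K"
  shows "(\<forall>a \<in> root_series K. \<forall>b \<in> root_series K. \<forall>q \<in> {0..1}. finite (conv_supp K a b q))
    \<and> cring (root_series_ring K)
    \<and> self_injective TYPE('m) TYPE('n) (root_series_ring K)
    \<and> totally_incoherent (root_series_ring K)
    \<and> (\<lambda>c. nilradical (root_series_ring K) +>\<^bsub>root_series_ring K\<^esub> const_series K c)
        \<in> ring_iso K (root_series_ring K Quot nilradical (root_series_ring K))"
proof -
  interpret root_series_field K using assms by (simp add: root_series_field_def)
  show ?thesis
  proof (intro conjI ballI)
    show "finite (conv_supp K a b q)" if "a \<in> root_series K" "b \<in> root_series K" "q \<in> {0..1}" for a b q
      using that finite_conv_supp unfolding carrier_P by simp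
  qed (rule cring_P self_injective_P totally_incoherent_P reduced_quotient_iso)+
qed

end
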